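(* For all positive integers $n$ and $s$ and every even positive integer $m=2k$, $$N(SO(2n+1),m,s)=\frac{s}{n}\binom{n}{s}\binom{m/2+1}{s},\qquad N(O(2n+1),m,s)=\frac{2s}{n}\binom{n}{s}\binom{m/2+1}{s}.$$
   Context: $O(2n+1)$ is the group of real $(2n+1)\times(2n+1)$ orthogonal matrices and $SO(2n+1)$ its subgroup of determinant-$1$ matrices. For real $\theta$ let $A(\theta)=\begin{pmatrix}\cos 2\pi\theta & \sin 2\pi\theta\\ -\sin 2\pi\theta & \cos2\pi\theta\end{pmatrix}$. Every element of $SO(2n+1)$ is conjugate in the group to $\mathrm{diag}(A(\theta_1),\dots,A(\theta_n),1)$, and every element of $O(2n+1)$ is conjugate in $O(2n+1)$ to $\mathrm{diag}(A(\theta_1),\dots,A(\theta_n),\pm1)$. Replacing each $\theta_l$ by the unique number in $[0,1/2]$ congruent to $\pm\theta_l$ modulo $1$, the number of distinct conjugate pairs of eigenvalues of the element is the number of distinct values among $\theta_1,\dots,\theta_n$ (the last diagonal entry $\pm1$ is not counted). $N(G,m,s)$ denotes the number of conjugacy classes of $G$ (under conjugation by elements of $G$) consisting of elements $x$ with $x^m=1$ having exactly $s$ distinct conjugate pairs of eigenvalues. *)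

theory Defs
  imports
    "HOL-Algebra.Group_Action"
    "HOL-Library.Real_Mod"
    "Jordan_Normal_Form.Determinant"
begin

definition orth_group :: "nat \<Rightarrow> real mat monoid" where
  "orth_group d =
     \<lparr>carrier = {x \<in> carrier_mat d d. transpose_mat x * x = 1\<^sub>m d}, monoid.mult = (*), one = 1\<^sub>m d\<rparr>"

definition special_orth_group :: "nat \<Rightarrow> real mat monoid" where
  "special_orth_group d = (orth_group d)\<lparr>carrier := {x \<in> carrier (orth_group d). det x = 1}\<rparr>"

definition conj_action :: "('a, 'b) monoid_scheme \<Rightarrow> 'a \<Rightarrow> 'a \<Rightarrow> 'a" where
  "conj_action G g = (\<lambda>h \<in> carrier G. g \<otimes>\<^bsub>G\<^esub> h \<otimes>\<^bsub>G\<^esub> inv\<^bsub>G\<^esub> g)"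

definition conj_class :: "('a, 'b) monoid_scheme \<Rightarrow> 'a \<Rightarrow> 'a set" where
  "conj_class G = orbit G (conj_action G)"

definition conj_classes :: "('a, 'b) monoid_scheme \<Rightarrow> 'a set set" where
  "conj_classes G = orbits G (carrier G) (conj_action G)"

definition rotation_block :: "real \<Rightarrow> real mat" where
  "rotation_block \<theta> = mat_of_rows_list 2
     [[cos (2 * pi * \<theta>), sin (2 * pi * \<theta>)],
      [- sin (2 * pi * \<theta>), cos (2 * pi * \<theta>)]]"

definition block_rotation :: "real list \<Rightarrow> real \<Rightarrow> real mat" where
  "block_rotation \<theta>s e = diag_block_mat (map rotation_block \<theta>s @ [mat 1 1 (\<lambda>_. e)])"

definition reduced_angle :: "real \<Rightarrow> real" where
  "reduced_angle \<theta> =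
     (THE t. t \<in> {0..1/2} \<and> ([t = \<theta>] (rmod 1) \<or> [t = - \<theta>] (rmod 1)))"

text \<open>
  For \<open>G\<close> one of the two groups in dimension \<open>2 * n + 1\<close> and \<open>x \<in> carrier G\<close>, membership
  of the block diagonal matrix in \<open>conj_class G x\<close> (a subset of \<open>carrier G\<close>) forces
  \<open>length \<theta>s = n\<close>, and also \<open>e = 1\<close> in the special orthogonal case. The number does not
  depend on the choice of the block diagonal conjugate, which justifies the definite
  description.
\<close>

definition num_eigenvalue_pairs :: "(real mat, 'b) monoid_scheme \<Rightarrow> real mat \<Rightarrow> nat" where
  "num_eigenvalue_pairs G x =
     (THE s. \<exists>\<theta>s e. e \<in> {1, -1} \<and> block_rotation \<theta>s e \<in> conj_class G x \<and>
        s = card (reduced_angle ` set \<theta>s))"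

definition classes_with_pairs ::
    "(real mat, 'b) monoid_scheme \<Rightarrow> nat \<Rightarrow> nat \<Rightarrow> real mat set set" where
  "classes_with_pairs G m s =
     {C \<in> conj_classes G. \<forall>x \<in> C. x [^]\<^bsub>G\<^esub> m = \<one>\<^bsub>G\<^esub> \<and> num_eigenvalue_pairs G x = s}"

definition N :: "(real mat, 'b) monoid_scheme \<Rightarrow> nat \<Rightarrow> nat \<Rightarrow> nat" where
  "N G m s = card (classes_with_pairs G m s)"

lemma group_orth_group: "group (orth_group d)"
proof (rule groupI)
  fix x y
  assume x: "x \<in> carrier (orth_group d)" and y: "y \<in> carrier (orth_group d)"
  have xc: "x \<in> carrier_mat d d" and yc: "y \<in> carrier_mat d d"
    and xo: "transpose_mat x * x = 1\<^sub>m d" and yo: "transpose_mat y * y = 1\<^sub>m d"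
    using x y by (auto simp: orth_group_def)
  have "transpose_mat (x * y) * (x * y) = (transpose_mat y * transpose_mat x) * (x * y)"
    using transpose_mult[OF xc yc] by simp
  also have "\<dots> = transpose_mat y * ((transpose_mat x * x) * y)"
    using xc yc by (simp add: assoc_mult_mat[of _ d d _ d _ d])
  finally have "transpose_mat (x * y) * (x * y) = 1\<^sub>m d"
    using xo yo yc by simp
  then show "x \<otimes>\<^bsub>orth_group d\<^esub> y \<in> carrier (orth_group d)"
    using xc yc by (auto simp: orth_group_def)
next
  fix x assume x: "x \<in> carrier (orth_group d)"
  then have xc: "x \<in> carrier_mat d d" and xo: "transpose_mat x * x = 1\<^sub>m d"
    by (auto simp: orth_group_def)
  have "x * transpose_mat x = 1\<^sub>m d"
    using mat_mult_left_right_inverse[OF _ xc xo] xc by simp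
  then show "\<exists>y \<in> carrier (orth_group d). y \<otimes>\<^bsub>orth_group d\<^esub> x = \<one>\<^bsub>orth_group d\<^esub>"
    using xc xo by (intro bexI[of _ "transpose_mat x"]) (auto simp: orth_group_def)
qed (auto simp: orth_group_def assoc_mult_mat[of _ d d _ d _ d])

lemma inv_orth_group:
  assumes "x \<in> carrier (orth_group d)"
  shows "inv\<^bsub>orth_group d\<^esub> x = transpose_mat x"
proof (rule group.inv_equality[OF group_orth_group])
  have "x \<in> carrier_mat d d" "transpose_mat x * x = 1\<^sub>m d"
    using assms by (auto simp: orth_group_def)
  moreover from this have "x * transpose_mat x = 1\<^sub>m d"
    using mat_mult_left_right_inverse[of "transpose_mat x" d x] by simp
  ultimately show "transpose_mat x \<otimes>\<^bsub>orth_group d\<^esub> x = \<one>\<^bsub>orth_group d\<^esub>"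
    and "transpose_mat x \<in> carrier (orth_group d)"
    by (auto simp: orth_group_def)
qed (fact assms)

lemma subgroup_special_orth_group:
  "subgroup (carrier (special_orth_group d)) (orth_group d)"
proof (rule group.subgroupI[OF group_orth_group])
  show "carrier (special_orth_group d) \<subseteq> carrier (orth_group d)"
    by (auto simp: special_orth_group_def)
  show "carrier (special_orth_group d) \<noteq> {}"
    by (auto simp: special_orth_group_def orth_group_def intro!: exI[of _ "1\<^sub>m d"])
next
  fix x assume "x \<in> carrier (special_orth_group d)"
  then have x: "x \<in> carrier (orth_group d)" and "det x = 1"
    by (auto simp: special_orth_group_def)
  moreover have "x \<in> carrier_mat d d"
    using x by (simp add: orth_group_def)
  ultimately show "inv\<^bsub>orth_group d\<^esub> x \<in> carrier (special_orth_group d)"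
    using group.inv_closed[OF group_orth_group x]
    by (simp add: special_orth_group_def inv_orth_group det_transpose)
next
  fix x y
  assume "x \<in> carrier (special_orth_group d)" "y \<in> carrier (special_orth_group d)"
  then have x: "x \<in> carrier (orth_group d)" "det x = 1"
    and y: "y \<in> carrier (orth_group d)" "det y = 1"
    by (auto simp: special_orth_group_def)
  have "det (x * y) = 1"
    using x y det_mult[of x d y] by (simp add: orth_group_def)
  then show "x \<otimes>\<^bsub>orth_group d\<^esub> y \<in> carrier (special_orth_group d)"
    using monoid.m_closed[OF group.is_monoid[OF group_orth_group] x(1) y(1)]
    by (simp add: special_orth_group_def) (simp add: orth_group_def)
qed

lemma group_special_orth_group: "group (special_orth_group d)"
  using group.subgroup_imp_group[OF group_orth_group subgroup_special_orth_group[of d]]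
  by (simp add: special_orth_group_def)

lemma ex1_reduced_angle:
  "\<exists>!t. t \<in> {0..1/2::real} \<and> ([t = \<theta>] (rmod 1) \<or> [t = - \<theta>] (rmod 1))"
proof (rule ex_ex1I)
  have "\<theta> = frac \<theta> + of_int \<lfloor>\<theta>\<rfloor> * 1" by (simp add: frac_def)
  then have 1: "[frac \<theta> = \<theta>] (rmod 1)" unfolding rcong_altdef by blast
  have "- \<theta> = (1 - frac \<theta>) + of_int (- \<lfloor>\<theta>\<rfloor> - 1) * 1" by (simp add: frac_def)
  then have 2: "[1 - frac \<theta> = - \<theta>] (rmod 1)" unfolding rcong_altdef by blast
  have "0 \<le> frac \<theta>" "frac \<theta> < 1" by (simp_all add: frac_lt_1)
  then show "\<exists>t. t \<in> {0..1/2::real} \<and> ([t = \<theta>] (rmod 1) \<or> [t = - \<theta>] (rmod 1))"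
    using 1 2 by (cases "frac \<theta> \<le> 1/2") (force intro: exI[of _ "frac \<theta>"] exI[of _ "1 - frac \<theta>"])+
next
  fix t u :: real
  assume t: "t \<in> {0..1/2} \<and> ([t = \<theta>] (rmod 1) \<or> [t = - \<theta>] (rmod 1))"
    and u: "u \<in> {0..1/2} \<and> ([u = \<theta>] (rmod 1) \<or> [u = - \<theta>] (rmod 1))"
  obtain a b :: int where a: "\<theta> = t + a \<or> - \<theta> = t + a" and b: "\<theta> = u + b \<or> - \<theta> = u + b"
    using t u by (auto simp: rcong_altdef)
  have "t - u = of_int (b - a) \<or> t + u = of_int (- a - b)"
    using a b by auto
  then have "(\<exists>k::int. t - u = k) \<or> (\<exists>k::int. t + u = k)"
    by blast
  then show "t = u"
  proof (elim disjE exE)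
    fix k :: int assume k: "t - u = k"
    then have "- 1 < real_of_int k" "real_of_int k < 1" using t u by auto
    then have "k = 0" by linarith
    with k show ?thesis by simp
  next
    fix k :: int assume k: "t + u = k"
    then have "0 \<le> real_of_int k" "real_of_int k \<le> 1" using t u by auto
    then have "k = 0 \<or> k = 1" by linarith
    with k t u show ?thesis by auto
  qed
qed

end

theory Submission
  imports Defs "Jordan_Normal_Form.Spectral_Radius"
begin

text \<open>
  An orthogonal matrix has a complex eigenvector, whose real and imaginary parts yield an invariant
  line or an invariant plane on which it acts as a rotation. Splitting these off, and pairing equal
  signs into rotations by \<open>0\<close> or \<open>1/2\<close>, gives the block diagonal normal form in odd dimension. The angles
  in \<open>[0, 1/2]\<close> are recovered from the characteristic polynomial and the last sign from the
  determinant, so the classes correspond to multisets of \<open>n\<close> angles \<open>j / m\<close> with \<open>0 \<le> j \<le> m / 2\<close>,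
  together with a sign. Those with \<open>s\<close> distinct angles number \<open>(m/2 + 1 choose s) (n - 1 choose s - 1)\<close>.
\<close>

section \<open>Block sums\<close>

definition block_sum :: "'a::zero mat \<Rightarrow> 'a mat \<Rightarrow> 'a mat" where
  "block_sum A B =
     four_block_mat A (0\<^sub>m (dim_row A) (dim_col B)) (0\<^sub>m (dim_row B) (dim_col A)) B"

lemma diag_block_mat_Cons: "diag_block_mat (A # As) = block_sum A (diag_block_mat As)"
  by (simp add: block_sum_def Let_def)

lemma block_sum_carrier:
  assumes "A \<in> carrier_mat a a'" "B \<in> carrier_mat b b'"
  shows "block_sum A B \<in> carrier_mat (a + b) (a' + b')"
  using assms by (auto simp: block_sum_def)

lemma block_sum_assoc: "block_sum A (block_sum B C) = block_sum (block_sum A B) C"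
  unfolding block_sum_def by (rule assoc_four_block_mat)

lemma block_sum_mult:
  fixes A B C D :: "'a::semiring_0 mat"
  assumes "A \<in> carrier_mat a a'" "B \<in> carrier_mat b b'"
    "C \<in> carrier_mat a' a''" "D \<in> carrier_mat b' b''"
  shows "block_sum A B * block_sum C D = block_sum (A * C) (B * D)"
proof -
  have d: "dim_row A = a" "dim_col A = a'" "dim_row B = b" "dim_col B = b'"
    "dim_row C = a'" "dim_col C = a''" "dim_row D = b'" "dim_col D = b''"
    using assms by auto
  have m: "A * C \<in> carrier_mat a a''" "B * D \<in> carrier_mat b b''" using assms by auto
  show ?thesis
    unfolding block_sum_def d
    using assms m
    by (subst mult_four_block_mat[of _ a a' _ b' _ b _ _ a'' _ b'']) (auto simp: d)
qed

lemma block_sum_transpose: "transpose_mat (block_sum A B) = block_sum (transpose_mat A) (transpose_mat B)"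
  unfolding block_sum_def
  by (subst transpose_four_block_mat[of _ "dim_row A" "dim_col A" _ "dim_col B" _ "dim_row B"]) auto

lemma block_sum_one: "block_sum (1\<^sub>m a) (1\<^sub>m b) = 1\<^sub>m (a + b)"
  by (simp add: block_sum_def)

lemma block_sum_det:
  fixes A B :: "'a::idom mat"
  assumes "A \<in> carrier_mat a a" "B \<in> carrier_mat b b"
  shows "det (block_sum A B) = det A * det B"
  unfolding block_sum_def using assms
  by (intro det_four_block_mat_lower_left_zero[of _ a _ b]) auto

lemma block_sum_eqD:
  assumes "block_sum A B = block_sum C D" "dim_row A = dim_row C" "dim_col A = dim_col C"
  shows "A = C" "B = D"
proof -
  have *: "dim_row B = dim_row D" "dim_col B = dim_col D"
    using arg_cong[OF assms(1), of dim_row] arg_cong[OF assms(1), of dim_col] assms(2,3)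
    by (auto simp: block_sum_def)
  have e: "block_sum A B $$ (i,j) = block_sum C D $$ (i,j)" for i j using assms(1) by simp
  show "A = C"
  proof (rule eq_matI)
    fix i j assume "i < dim_row C" "j < dim_col C"
    then show "A $$ (i,j) = C $$ (i,j)" using e[of i j] assms * by (auto simp: block_sum_def)
  qed (use assms in auto)
  show "B = D"
  proof (rule eq_matI)
    fix i j assume "i < dim_row D" "j < dim_col D"
    then show "B $$ (i,j) = D $$ (i,j)" 
      using e[of "i + dim_row A" "j + dim_col A"] assms * by (auto simp: block_sum_def)
  qed (use * in auto)
qed

section \<open>Orthogonal similarity\<close>

lemma orth_group_iff:
  "P \<in> carrier (orth_group d) \<longleftrightarrow> P \<in> carrier_mat d d \<and> transpose_mat P * P = 1\<^sub>m d"
  by (auto simp: orth_group_def)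

lemma orth_mult_transpose:
  assumes "P \<in> carrier (orth_group d)"
  shows "P * transpose_mat P = 1\<^sub>m d"
  using assms mat_mult_left_right_inverse[of "transpose_mat P" d P] by (auto simp: orth_group_iff)

lemma orth_transpose:
  assumes "P \<in> carrier (orth_group d)"
  shows "transpose_mat P \<in> carrier (orth_group d)"
  using assms orth_mult_transpose[OF assms] by (auto simp: orth_group_iff)

lemma orth_mult:
  assumes "P \<in> carrier (orth_group d)" "R \<in> carrier (orth_group d)"
  shows "P * R \<in> carrier (orth_group d)"
  using monoid.m_closed[OF group.is_monoid[OF group_orth_group] assms] by (simp add: orth_group_def)

lemma orth_one: "1\<^sub>m d \<in> carrier (orth_group d)"
  by (auto simp: orth_group_iff)

lemma orth_det:
  assumes "P \<in> carrier (orth_group d)"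
  shows "det P = 1 \<or> det P = -1"
proof -
  have "det (transpose_mat P * P) = det P * det P"
    using assms by (subst det_mult[of _ d]) (auto simp: orth_group_iff det_transpose)
  then have "(det P - 1) * (det P + 1) = 0"
    using assms by (simp add: orth_group_iff algebra_simps)
  then show ?thesis by auto
qed

lemma orth_block_sum:
  assumes "P \<in> carrier (orth_group a)" "R \<in> carrier (orth_group b)"
  shows "block_sum P R \<in> carrier (orth_group (a + b))"
  using assms block_sum_mult[of "transpose_mat P" a a "transpose_mat R" b b P a R b]
  by (auto simp: orth_group_iff block_sum_carrier block_sum_transpose block_sum_one)

definition orth_similar :: "nat \<Rightarrow> real mat \<Rightarrow> real mat \<Rightarrow> bool" where
  "orth_similar d A B \<longleftrightarrow> A \<in> carrier_mat d d \<and> B \<in> carrier_mat d d \<and>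
     (\<exists>P \<in> carrier (orth_group d). A * P = P * B)"

lemma orth_similar_refl: "A \<in> carrier_mat d d \<Longrightarrow> orth_similar d A A"
  using orth_one[of d] by (auto simp: orth_similar_def intro!: bexI[of _ "1\<^sub>m d"])

lemma orth_similar_sym:
  assumes "orth_similar d A B"
  shows "orth_similar d B A"
proof -
  obtain P where A: "A \<in> carrier_mat d d" and B: "B \<in> carrier_mat d d"
    and P: "P \<in> carrier (orth_group d)" and e: "A * P = P * B"
    using assms by (auto simp: orth_similar_def)
  let ?T = "transpose_mat P"
  have Pc: "P \<in> carrier_mat d d" and Tc: "?T \<in> carrier_mat d d" using P by (auto simp: orth_group_iff)
  have TP: "?T * P = 1\<^sub>m d" using P by (simp add: orth_group_iff)
  have "B * ?T = (?T * P) * B * ?T" using TP B by simp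
  also have "\<dots> = ?T * (P * B) * ?T" using A B Pc Tc by (simp add: assoc_mult_mat[of _ d d _ d _ d])
  also have "\<dots> = ?T * (A * P) * ?T" using e by simp
  also have "\<dots> = ?T * A * (P * ?T)" using A B Pc Tc by (simp add: assoc_mult_mat[of _ d d _ d _ d])
  also have "\<dots> = ?T * A" using orth_mult_transpose[OF P] A Tc by simp
  finally show ?thesis using A B orth_transpose[OF P] by (auto simp: orth_similar_def)
qed

lemma orth_similar_trans [trans]:
  assumes "orth_similar d A B" "orth_similar d B C"
  shows "orth_similar d A C"
proof -
  obtain P where A: "A \<in> carrier_mat d d" and B: "B \<in> carrier_mat d d"
    and P: "P \<in> carrier (orth_group d)" and e: "A * P = P * B"
    using assms(1) by (auto simp: orth_similar_def)
  obtain R where C: "C \<in> carrier_mat d d"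
    and R: "R \<in> carrier (orth_group d)" and f: "B * R = R * C"
    using assms(2) by (auto simp: orth_similar_def)
  have c: "P \<in> carrier_mat d d" "R \<in> carrier_mat d d" using P R by (auto simp: orth_group_iff)
  have "A * (P * R) = (A * P) * R" using A c by (simp add: assoc_mult_mat[of _ d d _ d _ d])
  also have "\<dots> = P * (B * R)" using e B c by (simp add: assoc_mult_mat[of _ d d _ d _ d])
  also have "\<dots> = (P * R) * C" using f C c by (simp add: assoc_mult_mat[of _ d d _ d _ d])
  finally show ?thesis using A C orth_mult[OF P R] by (auto simp: orth_similar_def)
qed

lemma orth_similar_block_sum:
  assumes "orth_similar a A A'" "orth_similar b B B'"
  shows "orth_similar (a + b) (block_sum A B) (block_sum A' B')"
proof -
  obtain P where A: "A \<in> carrier_mat a a" "A' \<in> carrier_mat a a"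
    and P: "P \<in> carrier (orth_group a)" and e: "A * P = P * A'"
    using assms(1) by (auto simp: orth_similar_def)
  obtain R where B: "B \<in> carrier_mat b b" "B' \<in> carrier_mat b b"
    and R: "R \<in> carrier (orth_group b)" and f: "B * R = R * B'"
    using assms(2) by (auto simp: orth_similar_def)
  have c: "P \<in> carrier_mat a a" "R \<in> carrier_mat b b" using P R by (auto simp: orth_group_iff)
  have "block_sum A B * block_sum P R = block_sum P R * block_sum A' B'"
    using A B c e f by (simp add: block_sum_mult[of _ a a _ b b])
  then show ?thesis using A B orth_block_sum[OF P R] by (auto simp: orth_similar_def block_sum_carrier)
qed

lemma orth_similar_block_sum_commute:
  assumes A: "A \<in> carrier_mat a a" and B: "B \<in> carrier_mat b b"
  shows "orth_similar (a + b) (block_sum A B) (block_sum B A)"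
proof -
  define P :: "real mat" where "P = four_block_mat (0\<^sub>m a b) (1\<^sub>m a) (1\<^sub>m b) (0\<^sub>m b a)"
  have Pc: "P \<in> carrier_mat (a + b) (a + b)"
    by (auto simp: P_def)
  have Pt: "transpose_mat P = four_block_mat (0\<^sub>m b a) (1\<^sub>m b) (1\<^sub>m a) (0\<^sub>m a b)"
    unfolding P_def by (subst transpose_four_block_mat[of _ a b _ a _ b]) auto
  have "transpose_mat P * P = 1\<^sub>m (b + a)"
    unfolding Pt unfolding P_def
    by (subst mult_four_block_mat[of _ b a _ b _ a _ _ b _ a]) auto
  then have P: "P \<in> carrier (orth_group (a + b))"
    using Pc by (simp add: orth_group_iff add.commute)
  have d: "dim_row A = a" "dim_col A = a" "dim_row B = b" "dim_col B = b" using A B by auto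
  have "block_sum A B * P = four_block_mat (0\<^sub>m a b) A B (0\<^sub>m b a)"
    unfolding block_sum_def P_def d using A B
    by (subst mult_four_block_mat[of _ a a _ b _ b _ _ b _ a]) auto
  also have "\<dots> = P * block_sum B A"
    unfolding block_sum_def P_def d using A B
    by (subst mult_four_block_mat[of _ a b _ a _ b _ _ b _ a]) auto
  finally show ?thesis
    using P A B block_sum_carrier[OF A B] block_sum_carrier[OF B A]
    by (auto simp: orth_similar_def add.commute)
qed

lemma orth_similar_orth:
  assumes "orth_similar d A B" "A \<in> carrier (orth_group d)"
  shows "B \<in> carrier (orth_group d)"
proof -
  obtain P where A: "A \<in> carrier_mat d d" and B: "B \<in> carrier_mat d d"
    and P: "P \<in> carrier (orth_group d)" and e: "A * P = P * B"
    using assms(1) by (auto simp: orth_similar_def)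
  have c: "P \<in> carrier_mat d d" "transpose_mat P \<in> carrier_mat d d" using P by (auto simp: orth_group_iff)
  have "B = (transpose_mat P * P) * B" using P B by (simp add: orth_group_iff)
  also have "\<dots> = transpose_mat P * (A * P)"
    using e B c by (simp add: assoc_mult_mat[of _ d d _ d _ d])
  finally show ?thesis using orth_mult orth_transpose P assms(2) by metis
qed

lemma orth_similar_det:
  assumes "orth_similar d A B"
  shows "det (x \<cdot>\<^sub>m 1\<^sub>m d + A) = det (x \<cdot>\<^sub>m 1\<^sub>m d + B)"
proof -
  obtain P where A: "A \<in> carrier_mat d d" and B: "B \<in> carrier_mat d d"
    and P: "P \<in> carrier (orth_group d)" and e: "A * P = P * B"
    using assms(1) by (auto simp: orth_similar_def)
  have c: "P \<in> carrier_mat d d" using P by (auto simp: orth_group_iff)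
  have "(x \<cdot>\<^sub>m 1\<^sub>m d + A) * P = x \<cdot>\<^sub>m P + A * P"
    using A c by (subst add_mult_distrib_mat[of _ d d _ _ d]) (auto simp: mult_smult_assoc_mat[of _ d d _ d])
  also have "\<dots> = P * (x \<cdot>\<^sub>m 1\<^sub>m d + B)"
    using B c by (subst mult_add_distrib_mat[of _ d d _ d]) (auto simp: mult_smult_distrib[of _ d d _ d] e)
  finally have "det (x \<cdot>\<^sub>m 1\<^sub>m d + A) * det P = det P * det (x \<cdot>\<^sub>m 1\<^sub>m d + B)"
    using A B c by (metis det_mult add_carrier_mat smult_carrier_mat one_carrier_mat)
  then show ?thesis using orth_det[OF P] by auto
qed

lemma orth_similar_pow:
  assumes "orth_similar d A B"
  shows "orth_similar d (A ^\<^sub>m k) (B ^\<^sub>m k)"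
proof -
  obtain P where A: "A \<in> carrier_mat d d" and B: "B \<in> carrier_mat d d"
    and P: "P \<in> carrier (orth_group d)" and e: "A * P = P * B"
    using assms(1) by (auto simp: orth_similar_def)
  have c: "P \<in> carrier_mat d d" using P by (auto simp: orth_group_iff)
  have "A ^\<^sub>m k * P = P * B ^\<^sub>m k"
  proof (induction k)
    case (Suc k)
    have pw: "A ^\<^sub>m k \<in> carrier_mat d d" "B ^\<^sub>m k \<in> carrier_mat d d" using A B by auto
    have "A ^\<^sub>m Suc k * P = A ^\<^sub>m k * (A * P)"
      using A c pw by (simp add: assoc_mult_mat[of _ d d _ d _ d])
    also have "\<dots> = (A ^\<^sub>m k * P) * B"
      using B c pw e by (simp add: assoc_mult_mat[of _ d d _ d _ d])
    also have "\<dots> = P * B ^\<^sub>m Suc k"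
      using B c pw Suc by (simp add: assoc_mult_mat[of _ d d _ d _ d])
    finally show ?case .
  qed (use A B c in auto)
  then show ?thesis using A B P by (auto simp: orth_similar_def)
qed

lemma orth_similar_oneD:
  assumes "orth_similar d A (1\<^sub>m d)"
  shows "A = 1\<^sub>m d"
proof -
  obtain P where A: "A \<in> carrier_mat d d"
    and P: "P \<in> carrier (orth_group d)" and e: "A * P = P"
    using assms(1) by (auto simp: orth_similar_def orth_group_iff)
  have c: "P \<in> carrier_mat d d" "transpose_mat P \<in> carrier_mat d d" using P by (auto simp: orth_group_iff)
  have "A = A * (P * transpose_mat P)" using A orth_mult_transpose[OF P] by simp
  also have "\<dots> = P * transpose_mat P" using A c e by (metis assoc_mult_mat)
  finally show ?thesis using orth_mult_transpose[OF P] by simp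
qed

section \<open>Orthonormal completion and invariant blocks\<close>

lemma four_block_mat_eqD:
  assumes "A \<in> carrier_mat a a'" "B \<in> carrier_mat a b'" "C \<in> carrier_mat b a'" "D \<in> carrier_mat b b'"
    "A2 \<in> carrier_mat a a'" "B2 \<in> carrier_mat a b'" "C2 \<in> carrier_mat b a'" "D2 \<in> carrier_mat b b'"
    and eq: "four_block_mat A B C D = four_block_mat A2 B2 C2 D2"
  shows "A = A2" "B = B2" "C = C2" "D = D2"
proof -
  have e: "four_block_mat A B C D $$ (i,j) = four_block_mat A2 B2 C2 D2 $$ (i,j)" for i j
    using eq by simp
  show "A = A2"
  proof (rule eq_matI)
    fix i j assume "i < dim_row A2" "j < dim_col A2"
    then show "A $$ (i,j) = A2 $$ (i,j)" using e[of i j] assms(1-8) by auto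
  qed (use assms(1-8) in auto)
  show "B = B2"
  proof (rule eq_matI)
    fix i j assume "i < dim_row B2" "j < dim_col B2"
    then show "B $$ (i,j) = B2 $$ (i,j)" using e[of i "j + a'"] assms(1-8) by auto
  qed (use assms(1-8) in auto)
  show "C = C2"
  proof (rule eq_matI)
    fix i j assume "i < dim_row C2" "j < dim_col C2"
    then show "C $$ (i,j) = C2 $$ (i,j)" using e[of "i + a" j] assms(1-8) by auto
  qed (use assms(1-8) in auto)
  show "D = D2"
  proof (rule eq_matI)
    fix i j assume "i < dim_row D2" "j < dim_col D2"
    then show "D $$ (i,j) = D2 $$ (i,j)" using e[of "i + a" "j + a'"] assms(1-8) by auto
  qed (use assms(1-8) in auto)
qed

lemma block_upper_triangular_isometry:
  fixes A B D :: "real mat"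
  assumes A: "A \<in> carrier_mat r r" and B: "B \<in> carrier_mat r c" and D: "D \<in> carrier_mat k c"
    and iso: "transpose_mat (four_block_mat A B (0\<^sub>m k r) D) * four_block_mat A B (0\<^sub>m k r) D = 1\<^sub>m (r + c)"
  shows "transpose_mat A * A = 1\<^sub>m r" "B = 0\<^sub>m r c" "transpose_mat D * D = 1\<^sub>m c"
proof -
  have "four_block_mat (transpose_mat A * A) (transpose_mat A * B) (transpose_mat B * A)
      (transpose_mat B * B + transpose_mat D * D)
    = transpose_mat (four_block_mat A B (0\<^sub>m k r) D) * four_block_mat A B (0\<^sub>m k r) D"
    using assms(1-3)
    by (subst transpose_four_block_mat[of _ r r _ c _ k], simp, simp, simp, simp,
        subst mult_four_block_mat[of _ r r _ k _ c _ _ r _ c]) auto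
  also have "\<dots> = four_block_mat (1\<^sub>m r) (0\<^sub>m r c) (0\<^sub>m c r) (1\<^sub>m c)"
    unfolding iso by simp
  finally have e: "four_block_mat (transpose_mat A * A) (transpose_mat A * B) (transpose_mat B * A)
      (transpose_mat B * B + transpose_mat D * D) = \<dots>" .
  have AA: "transpose_mat A * A = 1\<^sub>m r" and AB: "transpose_mat A * B = 0\<^sub>m r c"
    and BD: "transpose_mat B * B + transpose_mat D * D = 1\<^sub>m c"
    by (rule four_block_mat_eqD[OF _ _ _ _ _ _ _ _ e, where ?a = r and ?b = c and ?a' = r and ?b' = c];
        use assms(1-3) in auto)+
  show "transpose_mat A * A = 1\<^sub>m r" by fact
  have "A \<in> carrier (orth_group r)" using A AA by (simp add: orth_group_iff)
  from orth_mult_transpose[OF this] have "B = (A * transpose_mat A) * B" using B by simp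
  also have "\<dots> = A * (transpose_mat A * B)" using A B by (simp add: assoc_mult_mat[of _ r r _ r _ c])
  finally show B0: "B = 0\<^sub>m r c" using AB A by simp
  show "transpose_mat D * D = 1\<^sub>m c" using BD D unfolding B0 by simp
qed

definition frame :: "nat \<Rightarrow> nat \<Rightarrow> real mat" where
  "frame d r = mat d r (\<lambda>(i,j). if i = j then 1 else 0)"

lemma frame_carrier [simp]: "frame d r \<in> carrier_mat d r"
  by (simp add: frame_def)

lemma frame_Suc: "frame (Suc d) (Suc r) = block_sum (1\<^sub>m 1) (frame d r)"
  by (rule eq_matI) (auto simp: frame_def block_sum_def)

lemma mult_frame_index:
  assumes "M \<in> carrier_mat a d" "i < a" "j < r" "r \<le> d"
  shows "(M * frame d r) $$ (i,j) = M $$ (i,j)"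
proof -
  have "(M * frame d r) $$ (i,j) = (\<Sum>k = 0..<d. M $$ (i,k) * (if k = j then 1 else 0))"
    using assms by (auto simp: frame_def scalar_prod_def intro!: sum.cong)
  also have "\<dots> = M $$ (i,j)" using assms by (simp add: if_distrib sum.delta cong: if_cong)
  finally show ?thesis .
qed

lemma frame_mult_index:
  assumes "R \<in> carrier_mat r c" "i < d" "j < c"
  shows "(frame d r * R) $$ (i,j) = (if i < r then R $$ (i,j) else 0)"
proof -
  have "(frame d r * R) $$ (i,j) = (\<Sum>k = 0..<r. (if i = k then 1 else 0) * R $$ (k,j))"
    using assms by (auto simp: frame_def scalar_prod_def intro!: sum.cong)
  also have "\<dots> = (\<Sum>k = 0..<r. if i = k then R $$ (k,j) else 0)"
    by (intro sum.cong) auto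
  finally show ?thesis using assms by simp
qed

lemma scalar_prod_self_eq_0D:
  fixes v :: "real vec"
  assumes "v \<in> carrier_vec d" "v \<bullet> v = 0"
  shows "v = 0\<^sub>v d"
proof -
  have "(\<Sum>i = 0..<d. v $ i * v $ i) = 0" using assms by (simp add: scalar_prod_def)
  then have "\<forall>i < d. v $ i = 0" by (subst (asm) sum_nonneg_eq_0_iff) auto
  then show ?thesis using assms by (intro eq_vecI) auto
qed

text \<open>The witness is the Householder reflection exchanging the first basis vector and \<open>a\<close>.\<close>

lemma ex_orth_first_column:
  fixes a :: "real vec"
  assumes a: "a \<in> carrier_vec d" and aa: "a \<bullet> a = 1" and d: "d > 0"
  shows "\<exists>H \<in> carrier (orth_group d). H *\<^sub>v unit_vec d 0 = a"
proof (cases "a = unit_vec d 0")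
  case True
  then show ?thesis using orth_one[of d] d by (intro bexI[of _ "1\<^sub>m d"]) auto
next
  case False
  define w where "w = a - unit_vec d 0"
  define t where "t = 1 - a $ 0"
  have wc: "w \<in> carrier_vec d" using a by (simp add: w_def)
  have "w \<bullet> w = a \<bullet> a - 2 * (a \<bullet> unit_vec d 0) + unit_vec d 0 \<bullet> unit_vec d 0"
    unfolding w_def using a d
    by (simp add: minus_scalar_prod_distrib[of _ d] scalar_prod_minus_distrib[of _ d]
        comm_scalar_prod[of "unit_vec d 0" d a])
  then have ww: "w \<bullet> w = 2 * t" using a d aa by (simp add: t_def)
  have "w \<noteq> 0\<^sub>v d"
  proof
    assume w0: "w = 0\<^sub>v d"
    have "a = w + unit_vec d 0" unfolding w_def using a by (intro eq_vecI) auto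
    then show False using False w0 by simp
  qed
  then have t: "t \<noteq> 0" using ww scalar_prod_self_eq_0D[OF wc] by auto
  define H where "H = mat d d (\<lambda>(i,j). (if i = j then 1 else 0) - w $ i * w $ j / t)"
  have Hc: "H \<in> carrier_mat d d" by (simp add: H_def)
  have sw: "(\<Sum>k = 0..<d. w $ k * w $ k) = 2 * t" using ww wc by (simp add: scalar_prod_def)
  have "transpose_mat H * H = 1\<^sub>m d"
  proof (rule eq_matI)
    fix i j assume "i < dim_row (1\<^sub>m d :: real mat)" "j < dim_col (1\<^sub>m d :: real mat)"
    then have ij: "i < d" "j < d" by auto
    have "(transpose_mat H * H) $$ (i,j) = (\<Sum>k = 0..<d.
        ((if k = i then 1 else 0) - w $ k * w $ i / t) * ((if k = j then 1 else 0) - w $ k * w $ j / t))"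
      using ij by (auto simp: H_def scalar_prod_def intro!: sum.cong)
    also have "\<dots> = (\<Sum>k = 0..<d. (if k = i then (if i = j then 1 else 0) else 0)
        - (if k = j then w $ k * w $ i / t else 0) - (if k = i then w $ k * w $ j / t else 0)
        + (w $ k * w $ k) * (w $ i * w $ j / t\<^sup>2))"
      by (intro sum.cong refl) (auto simp: algebra_simps power2_eq_square)
    also have "\<dots> = (if i = j then 1 else 0) - 2 * (w $ i * w $ j / t) + (2 * t) * (w $ i * w $ j / t\<^sup>2)"
      using ij unfolding sum.distrib sum_subtractf sum_distrib_right[symmetric] sw by simp
    also have "\<dots> = 1\<^sub>m d $$ (i,j)" using ij t by (simp add: power2_eq_square)
    finally show "(transpose_mat H * H) $$ (i,j) = 1\<^sub>m d $$ (i,j)" .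
  qed (auto simp: H_def)
  moreover have "H *\<^sub>v unit_vec d 0 = a"
  proof (rule eq_vecI)
    fix i assume "i < dim_vec a"
    then have i: "i < d" using a by simp
    have "(H *\<^sub>v unit_vec d 0) $ i = (if i = 0 then 1 else 0) - w $ i * w $ 0 / t"
      using i d by (simp add: H_def)
    also have "w $ 0 = - t" using a d by (simp add: w_def t_def)
    finally show "(H *\<^sub>v unit_vec d 0) $ i = a $ i"
      using t i a d by (auto simp: w_def)
  qed (use a in \<open>simp add: H_def\<close>)
  ultimately show ?thesis using Hc by (auto simp: orth_group_iff)
qed

lemma ex_orth_completion:
  assumes "X \<in> carrier_mat d r" "transpose_mat X * X = 1\<^sub>m r" "r \<le> d"
  shows "\<exists>P \<in> carrier (orth_group d). P * frame d r = X"
  using assms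
proof (induction r arbitrary: d X)
  case 0
  then show ?case using orth_one[of d] by (intro bexI[of _ "1\<^sub>m d"]) (auto simp: frame_def)
next
  case (Suc r d' X)
  then obtain d where d': "d' = Suc d" by (cases d') auto
  note X = Suc.prems[unfolded d']
  define a where "a = col X 0"
  have a: "a \<in> carrier_vec (Suc d)" unfolding a_def using X(1) by (metis col_dim carrier_matD(1))
  have "(transpose_mat X * X) $$ (0,0) = a \<bullet> a" using X(1) by (simp add: a_def)
  then have "a \<bullet> a = 1" using X(2) by simp
  then obtain H where H: "H \<in> carrier (orth_group (Suc d))" and Ha: "H *\<^sub>v unit_vec (Suc d) 0 = a"
    using ex_orth_first_column[OF a] by auto
  have Hc: "H \<in> carrier_mat (Suc d) (Suc d)" "transpose_mat H \<in> carrier_mat (Suc d) (Suc d)"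
    using H by (auto simp: orth_group_iff)
  define Y where "Y = transpose_mat H * X"
  have Yc: "Y \<in> carrier_mat (Suc d) (Suc r)" using Hc X by (auto simp: Y_def)
  have HY: "H * Y = X"
    unfolding Y_def using Hc X orth_mult_transpose[OF H]
    by (subst assoc_mult_mat[symmetric, of _ "Suc d" "Suc d" _ "Suc d" _ "Suc r"]) auto
  have "transpose_mat Y * Y = transpose_mat X * H * Y"
    unfolding Y_def using Hc X by (subst transpose_mult[of _ "Suc d" "Suc d" _ "Suc r"]) auto
  also have "\<dots> = 1\<^sub>m (Suc r)"
    using Hc X Yc by (simp add: assoc_mult_mat[of _ "Suc r" "Suc d" _ "Suc d" _ "Suc r"] HY)
  finally have YY: "transpose_mat Y * Y = 1\<^sub>m (1 + r)" by simp
  have "transpose_mat H *\<^sub>v a = unit_vec (Suc d) 0"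
    using Hc H unfolding Ha[symmetric]
    by (subst assoc_mult_mat_vec[symmetric, of _ "Suc d" "Suc d" _ "Suc d"]) (auto simp: orth_group_iff)
  moreover have "Y $$ (i,0) = (transpose_mat H *\<^sub>v a) $ i" if "i < Suc d" for i
    using that Hc X unfolding Y_def a_def by simp
  ultimately have Y0: "Y $$ (i,0) = unit_vec (Suc d) 0 $ i" if "i < Suc d" for i
    using that by simp
  obtain A B C D where spl: "split_block Y 1 1 = (A,B,C,D)" by (cases "split_block Y 1 1") auto
  note s = split_block[OF spl, of d r]
  have dims: "dim_row Y = 1 + d" "dim_col Y = 1 + r" using Yc by auto
  note s = s[OF dims]
  have "C = 0\<^sub>m d 1"
    using spl Y0 Yc by (intro eq_matI) (auto simp: split_block_def Let_def)
  then have Y: "Y = four_block_mat A B (0\<^sub>m d 1) D" using s by simp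
  note t = block_upper_triangular_isometry[OF s(1,2,4) YY[unfolded Y]]
  have "A = 1\<^sub>m 1"
    using spl Y0 Yc by (intro eq_matI) (auto simp: split_block_def Let_def)
  then have YD: "Y = block_sum (1\<^sub>m 1) D"
    unfolding Y block_sum_def using t(2) s by auto
  from Suc.IH[OF s(4) t(3)] obtain P where
    P: "P \<in> carrier (orth_group d)" and PD: "P * frame d r = D" using X(3) by auto
  have Pc: "P \<in> carrier_mat d d" using P by (auto simp: orth_group_iff)
  have bs: "block_sum (1\<^sub>m 1) P \<in> carrier (orth_group (Suc d))"
    using orth_block_sum[OF orth_one[of 1] P] by simp
  then have bsc: "block_sum (1\<^sub>m 1) P \<in> carrier_mat (Suc d) (Suc d)" by (simp add: orth_group_iff)
  have "(H * block_sum (1\<^sub>m 1) P) * frame (Suc d) (Suc r)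
      = H * (block_sum (1\<^sub>m 1) P * frame (Suc d) (Suc r))"
    using Hc bsc by (intro assoc_mult_mat[of _ "Suc d" "Suc d" _ "Suc d" _ "Suc r"]) auto
  also have "block_sum (1\<^sub>m 1) P * frame (Suc d) (Suc r) = Y"
    unfolding frame_Suc YD using Pc PD by (subst block_sum_mult[of _ 1 1 _ d d _ 1 _ r]) auto
  finally show ?case unfolding d' HY using orth_mult[OF H bs] by blast
qed

lemma orth_similar_invariant_block:
  assumes Q: "Q \<in> carrier (orth_group d)" and X: "X \<in> carrier_mat d r"
    and iso: "transpose_mat X * X = 1\<^sub>m r" and r: "r \<le> d"
    and R: "R \<in> carrier_mat r r" and QX: "Q * X = X * R"
  shows "R \<in> carrier (orth_group r)"
    "\<exists>Q' \<in> carrier (orth_group (d - r)). orth_similar d Q (block_sum R Q')"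
proof -
  obtain P where P: "P \<in> carrier (orth_group d)" and PX: "P * frame d r = X"
    using ex_orth_completion[OF X iso r] by auto
  let ?T = "transpose_mat P"
  have c: "P \<in> carrier_mat d d" "?T \<in> carrier_mat d d" "Q \<in> carrier_mat d d"
    using P Q by (auto simp: orth_group_iff)
  define M where "M = ?T * (Q * P)"
  have M: "M \<in> carrier (orth_group d)" unfolding M_def
    by (intro orth_mult orth_transpose P Q)
  then have Mc: "M \<in> carrier_mat d d" by (simp add: orth_group_iff)
  have "P * M = (P * ?T) * (Q * P)"
    unfolding M_def using c by (simp add: assoc_mult_mat[of _ d d _ d _ d])
  then have "Q * P = P * M" using c orth_mult_transpose[OF P] by simp
  then have sim: "orth_similar d Q M" using c Mc P by (auto simp: orth_similar_def)
  have TX: "?T * X = frame d r"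
    unfolding PX[symmetric] using P c
    by (subst assoc_mult_mat[symmetric, of _ d d _ d _ r]) (auto simp: orth_group_iff left_mult_one_mat[of _ d r])
  have "M * frame d r = ?T * (Q * X)"
    unfolding M_def PX[symmetric] using c by (simp add: assoc_mult_mat[of _ d d _ d _ r])
  also have "\<dots> = frame d r * R"
    unfolding QX using c X R by (subst assoc_mult_mat[symmetric, of _ d d _ r _ r]) (auto simp: TX)
  finally have MR: "M $$ (i,j) = (if i < r then R $$ (i,j) else 0)" if "i < d" "j < r" for i j
    using mult_frame_index[OF Mc that r] frame_mult_index[OF R that] by simp
  obtain A B C D where spl: "split_block M r r = (A,B,C,D)" by (cases "split_block M r r") auto
  have dims: "dim_row M = r + (d - r)" "dim_col M = r + (d - r)" using Mc r by auto
  note s = split_block[OF spl dims]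
  have A: "A = R" using spl MR Mc R r by (intro eq_matI) (auto simp: split_block_def Let_def)
  have C: "C = 0\<^sub>m (d - r) r"
    using spl MR Mc r by (intro eq_matI) (auto simp: split_block_def Let_def)
  have "transpose_mat M * M = 1\<^sub>m (r + (d - r))" using M r by (simp add: orth_group_iff)
  note t = block_upper_triangular_isometry[OF s(1,2,4) this[unfolded s(5) C]]
  show "R \<in> carrier (orth_group r)" using t(1) A R by (simp add: orth_group_iff)
  have "M = block_sum R D" unfolding s(5) block_sum_def using A C t(2) s R by auto
  moreover have "D \<in> carrier (orth_group (d - r))" using t(3) s(4) by (simp add: orth_group_iff)
  ultimately show "\<exists>Q' \<in> carrier (orth_group (d - r)). orth_similar d Q (block_sum R Q')"
    using sim by auto
qed

section \<open>Normal form of orthogonal matrices\<close>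

lemma rotation_block_carrier [simp]: "rotation_block t \<in> carrier_mat 2 2"
  by (simp add: rotation_block_def mat_of_rows_list_def numeral_2_eq_2)

lemma rotation_block_dim [simp]: "dim_row (rotation_block t) = 2" "dim_col (rotation_block t) = 2"
  using carrier_matD[OF rotation_block_carrier] by auto

lemma rotation_block_index:
  "rotation_block t $$ (0,0) = cos (2 * pi * t)" "rotation_block t $$ (0,Suc 0) = sin (2 * pi * t)"
  "rotation_block t $$ (Suc 0,0) = - sin (2 * pi * t)" "rotation_block t $$ (Suc 0,Suc 0) = cos (2 * pi * t)"
  by (simp_all add: rotation_block_def mat_of_rows_list_def)

text \<open>A complex eigenvector \<open>x + i y\<close> of an orthogonal matrix has an eigenvalue \<open>a + i b\<close> of modulus 1,
  so both \<open>x\<close> and \<open>y\<close> are eigenvectors of the symmetric part for the eigenvalue \<open>a\<close>.\<close>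

lemma orth_symmetric_part_eigenvector:
  assumes Q: "Q \<in> carrier (orth_group d)" and d: "d > 0"
  shows "\<exists>v c. v \<in> carrier_vec d \<and> v \<bullet> v = 1 \<and>
    Q *\<^sub>v v + transpose_mat Q *\<^sub>v v = (2 * c) \<cdot>\<^sub>v v"
proof -
  have Qc: "Q \<in> carrier_mat d d" "transpose_mat Q \<in> carrier_mat d d" using Q by (auto simp: orth_group_iff)
  let ?C = "map_mat complex_of_real Q"
  have Cc: "?C \<in> carrier_mat d d" using Qc by simp
  obtain \<mu> where "eigenvalue ?C \<mu>" using spectrum_non_empty[OF Cc d] by (auto simp: spectrum_def)
  then obtain z where z: "z \<in> carrier_vec d" "z \<noteq> 0\<^sub>v d" and ev: "?C *\<^sub>v z = \<mu> \<cdot>\<^sub>v z"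
    using Cc by (auto simp: eigenvalue_def eigenvector_def)
  define x where "x = map_vec Re z"
  define y where "y = map_vec Im z"
  define a where "a = Re \<mu>"
  define b where "b = Im \<mu>"
  have xy: "x \<in> carrier_vec d" "y \<in> carrier_vec d" using z by (auto simp: x_def y_def)
  have evi: "(\<Sum>j = 0..<d. complex_of_real (Q $$ (i,j)) * z $ j) = \<mu> * z $ i" if "i < d" for i
    using arg_cong[OF ev, of "\<lambda>w. w $ i"] that z Qc by (simp add: scalar_prod_def)
  have Qx: "Q *\<^sub>v x = a \<cdot>\<^sub>v x - b \<cdot>\<^sub>v y"
  proof (rule eq_vecI)
    fix i assume "i < dim_vec (a \<cdot>\<^sub>v x - b \<cdot>\<^sub>v y)"
    then have i: "i < d" using xy by simp
    show "(Q *\<^sub>v x) $ i = (a \<cdot>\<^sub>v x - b \<cdot>\<^sub>v y) $ i"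
      using arg_cong[OF evi[OF i], of Re] i xy Qc z
      by (simp add: scalar_prod_def x_def y_def a_def b_def)
  qed (use Qc xy in auto)
  have Qy: "Q *\<^sub>v y = b \<cdot>\<^sub>v x + a \<cdot>\<^sub>v y"
  proof (rule eq_vecI)
    fix i assume "i < dim_vec (b \<cdot>\<^sub>v x + a \<cdot>\<^sub>v y)"
    then have i: "i < d" using xy by simp
    show "(Q *\<^sub>v y) $ i = (b \<cdot>\<^sub>v x + a \<cdot>\<^sub>v y) $ i"
      using arg_cong[OF evi[OF i], of Im] i xy Qc z
      by (simp add: scalar_prod_def x_def y_def a_def b_def)
  qed (use Qc xy in auto)
  have TQ: "transpose_mat Q *\<^sub>v (Q *\<^sub>v w) = w" if "w \<in> carrier_vec d" for w
    using Q Qc that by (subst assoc_mult_mat_vec[symmetric, of _ d d _ d]) (auto simp: orth_group_iff)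
  define p where "p = transpose_mat Q *\<^sub>v x"
  define q where "q = transpose_mat Q *\<^sub>v y"
  have pq: "p \<in> carrier_vec d" "q \<in> carrier_vec d" using Qc xy by (auto simp: p_def q_def)
  have "x = a \<cdot>\<^sub>v p - b \<cdot>\<^sub>v q"
    using TQ[OF xy(1)] Qc xy unfolding Qx p_def q_def
    by (simp add: mult_minus_distrib_mat_vec[of _ d d] mult_mat_vec[of _ d d])
  then have xi: "x $ i = a * p $ i - b * q $ i" if "i < d" for i
    using that pq by (metis index_minus_vec(1) index_smult_vec(1,2) carrier_vecD)
  have "y = b \<cdot>\<^sub>v p + a \<cdot>\<^sub>v q"
    using TQ[OF xy(2)] Qc xy unfolding Qy p_def q_def
    by (simp add: mult_add_distrib_mat_vec[of _ d d] mult_mat_vec[of _ d d])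
  then have yi: "y $ i = b * p $ i + a * q $ i" if "i < d" for i
    using that pq by (metis index_add_vec(1) index_smult_vec(1,2) carrier_vecD)
  have iso: "(Q *\<^sub>v w) \<bullet> (Q *\<^sub>v w) = w \<bullet> w" if w: "w \<in> carrier_vec d" for w
  proof -
    have "(Q *\<^sub>v w) \<bullet> (Q *\<^sub>v w) = w \<bullet> (transpose_mat Q *\<^sub>v (Q *\<^sub>v w))"
      using transpose_vec_mult_scalar[of "Q" d d w "Q *\<^sub>v w"] Qc w
      by (simp add: comm_scalar_prod[of _ d])
    then show ?thesis using TQ[OF w] by simp
  qed
  have pos: "x \<bullet> x + y \<bullet> y \<noteq> 0"
  proof
    assume "x \<bullet> x + y \<bullet> y = 0"
    moreover have "x \<bullet> x \<ge> 0" "y \<bullet> y \<ge> 0" by (auto simp: scalar_prod_def intro!: sum_nonneg)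
    ultimately have "x \<bullet> x = 0" "y \<bullet> y = 0" by auto
    then have "x = 0\<^sub>v d" "y = 0\<^sub>v d" using xy scalar_prod_self_eq_0D by auto
    then have "x $ i = 0" "y $ i = 0" if "i < d" for i using that by auto
    then have "z = 0\<^sub>v d" using z by (intro eq_vecI) (auto simp: x_def y_def complex_eq_iff)
    then show False using z by simp
  qed
  have "x \<bullet> x + y \<bullet> y = (a \<cdot>\<^sub>v x - b \<cdot>\<^sub>v y) \<bullet> (a \<cdot>\<^sub>v x - b \<cdot>\<^sub>v y) + (b \<cdot>\<^sub>v x + a \<cdot>\<^sub>v y) \<bullet> (b \<cdot>\<^sub>v x + a \<cdot>\<^sub>v y)"
    using iso[OF xy(1)] iso[OF xy(2)] unfolding Qx Qy by simp
  also have "\<dots> = (a\<^sup>2 + b\<^sup>2) * (x \<bullet> x + y \<bullet> y)"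
    using xy by (simp add: minus_scalar_prod_distrib[of _ d] scalar_prod_minus_distrib[of _ d]
      add_scalar_prod_distrib[of _ d] scalar_prod_add_distrib[of _ d] comm_scalar_prod[of y d x])
      (simp add: algebra_simps power2_eq_square)
  finally have ab: "a\<^sup>2 + b\<^sup>2 = 1" using pos by simp
  have p: "p $ i = a * x $ i + b * y $ i" if "i < d" for i
  proof -
    have "a * x $ i + b * y $ i = (a\<^sup>2 + b\<^sup>2) * p $ i"
      unfolding xi[OF that] yi[OF that] by (simp add: algebra_simps power2_eq_square)
    then show ?thesis using ab by simp
  qed
  have q: "q $ i = a * y $ i - b * x $ i" if "i < d" for i
  proof -
    have "a * y $ i - b * x $ i = (a\<^sup>2 + b\<^sup>2) * q $ i"
      unfolding xi[OF that] yi[OF that] by (simp add: algebra_simps power2_eq_square)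
    then show ?thesis using ab by simp
  qed
  have Sx: "Q *\<^sub>v x + transpose_mat Q *\<^sub>v x = (2 * a) \<cdot>\<^sub>v x"
    unfolding Qx p_def[symmetric] using xy pq by (intro eq_vecI) (auto simp: p)
  have Sy: "Q *\<^sub>v y + transpose_mat Q *\<^sub>v y = (2 * a) \<cdot>\<^sub>v y"
    unfolding Qy q_def[symmetric] using xy pq by (intro eq_vecI) (auto simp: q)
  obtain w where w: "w \<in> carrier_vec d" "w \<bullet> w \<noteq> 0"
    and Sw: "Q *\<^sub>v w + transpose_mat Q *\<^sub>v w = (2 * a) \<cdot>\<^sub>v w"
    using pos Sx Sy xy by (cases "x \<bullet> x = 0") auto
  have "w \<bullet> w \<ge> 0" by (auto simp: scalar_prod_def intro!: sum_nonneg)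
  define r where "r = 1 / sqrt (w \<bullet> w)"
  have "r * r * (w \<bullet> w) = 1" using w \<open>w \<bullet> w \<ge> 0\<close> by (simp add: r_def)
  then have "(r \<cdot>\<^sub>v w) \<bullet> (r \<cdot>\<^sub>v w) = 1" using w by simp
  moreover have "Q *\<^sub>v (r \<cdot>\<^sub>v w) + transpose_mat Q *\<^sub>v (r \<cdot>\<^sub>v w) = (2 * a) \<cdot>\<^sub>v (r \<cdot>\<^sub>v w)"
  proof -
    have "Q *\<^sub>v (r \<cdot>\<^sub>v w) + transpose_mat Q *\<^sub>v (r \<cdot>\<^sub>v w) = r \<cdot>\<^sub>v (Q *\<^sub>v w + transpose_mat Q *\<^sub>v w)"
      using w Qc by (simp add: mult_mat_vec[of _ d d] smult_add_distrib_vec[of _ d])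
    then show ?thesis unfolding Sw by (simp add: smult_smult_assoc mult.commute)
  qed
  ultimately show ?thesis using w by (intro exI[of _ "r \<cdot>\<^sub>v w"] exI[of _ a]) auto
qed

lemma orth_similar_peel:
  assumes Q: "Q \<in> carrier (orth_group d)" and d: "d > 0"
  shows "(\<exists>e Q'. e \<in> {1,-1} \<and> Q' \<in> carrier (orth_group (d - 1)) \<and>
        orth_similar d Q (block_sum (mat 1 1 (\<lambda>_. e)) Q')) \<or>
    (d \<ge> 2 \<and> (\<exists>t Q'. Q' \<in> carrier (orth_group (d - 2)) \<and> orth_similar d Q (block_sum (rotation_block t) Q')))"
proof -
  obtain v c where v: "v \<in> carrier_vec d" and vv: "v \<bullet> v = 1"
    and S: "Q *\<^sub>v v + transpose_mat Q *\<^sub>v v = (2 * c) \<cdot>\<^sub>v v"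
    using orth_symmetric_part_eigenvector[OF Q d] by auto
  have Qc: "Q \<in> carrier_mat d d" "transpose_mat Q \<in> carrier_mat d d" using Q by (auto simp: orth_group_iff)
  define u where "u = Q *\<^sub>v v"
  define u' where "u' = transpose_mat Q *\<^sub>v v"
  have u: "u \<in> carrier_vec d" "u' \<in> carrier_vec d" using Qc v by (auto simp: u_def u'_def)
  have uu: "u \<bullet> u = 1"
  proof -
    have "transpose_mat Q *\<^sub>v (Q *\<^sub>v v) = v"
      using Q Qc v by (subst assoc_mult_mat_vec[symmetric, of _ d d _ d]) (auto simp: orth_group_iff)
    then show ?thesis
      using transpose_vec_mult_scalar[of Q d d v "Q *\<^sub>v v"] Qc v vv
      by (simp add: u_def comm_scalar_prod[of _ d])
  qed
  have S': "u $ i + u' $ i = 2 * c * v $ i" if "i < d" for i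
    using arg_cong[OF S[folded u_def u'_def], of "\<lambda>w. w $ i"] that u v by simp
  have Qu: "Q *\<^sub>v u = (2 * c) \<cdot>\<^sub>v u - v"
  proof -
    have "Q *\<^sub>v (u + u') = Q *\<^sub>v u + v"
      using Qc u v orth_mult_transpose[OF Q] unfolding u'_def
      by (simp add: mult_add_distrib_mat_vec[of _ d d] assoc_mult_mat_vec[symmetric, of _ d d _ d])
    moreover have "Q *\<^sub>v (u + u') = (2 * c) \<cdot>\<^sub>v u"
      using S Qc v unfolding u_def u'_def by (simp add: mult_mat_vec[of _ d d])
    ultimately have e: "Q *\<^sub>v u + v = (2 * c) \<cdot>\<^sub>v u" by simp
    show ?thesis
    proof (rule eq_vecI)
      fix i assume "i < dim_vec ((2 * c) \<cdot>\<^sub>v u - v)"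
      then have "i < d" using v by simp
      then show "(Q *\<^sub>v u) $ i = ((2 * c) \<cdot>\<^sub>v u - v) $ i"
        using arg_cong[OF e, of "\<lambda>w. w $ i"] Qc u v by (simp del: index_mult_mat_vec)
    qed (use Qc v in auto)
  qed
  have vu: "v \<bullet> u = c"
  proof -
    have "v \<bullet> u + v \<bullet> u' = v \<bullet> (u + u')" using u v by (simp add: scalar_prod_add_distrib[of _ d])
    also have "\<dots> = 2 * c" using S v vv by (simp add: u_def u'_def)
    finally have "v \<bullet> u + v \<bullet> u' = 2 * c" .
    moreover have "u' \<bullet> v = v \<bullet> u"
      unfolding u'_def u_def by (rule transpose_vec_mult_scalar[OF Qc(1) v v])
    ultimately show ?thesis using u v by (simp add: comm_scalar_prod[of v d u'])
  qed
  define w where "w = u - c \<cdot>\<^sub>v v"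
  have w: "w \<in> carrier_vec d" using u v by (simp add: w_def)
  have vw: "v \<bullet> w = 0" using u v vu vv by (simp add: w_def scalar_prod_minus_distrib[of _ d])
  have uw: "u = c \<cdot>\<^sub>v v + w" unfolding w_def using u v by (intro eq_vecI) auto
  have ww: "w \<bullet> w = 1 - c\<^sup>2"
  proof -
    have "u \<bullet> u = (c \<cdot>\<^sub>v v + w) \<bullet> (c \<cdot>\<^sub>v v + w)" using uw by simp
    also have "\<dots> = c\<^sup>2 * (v \<bullet> v) + w \<bullet> w"
      using v w vw by (simp add: add_scalar_prod_distrib[of _ d] scalar_prod_add_distrib[of _ d]
        comm_scalar_prod[of w d v] power2_eq_square)
    finally show ?thesis using vv uu by simp
  qed
  show ?thesis
  proof (cases "c\<^sup>2 = 1")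
    case True
    then have "w = 0\<^sub>v d" using ww w scalar_prod_self_eq_0D by simp
    then have uv: "u = c \<cdot>\<^sub>v v" using uw v by simp
    have e: "c \<in> {1,-1}" using True by (auto simp: power2_eq_1_iff)
    define X where "X = mat_of_cols d [v]"
    have X: "X \<in> carrier_mat d 1" using mat_of_cols_carrier(1)[of d "[v]"] by (simp add: X_def)
    have "transpose_mat X * X = 1\<^sub>m 1"
      using v vv by (intro eq_matI) (auto simp: X_def)
    moreover have "Q * X = X * mat 1 1 (\<lambda>_. c)"
    proof (rule eq_matI)
      fix i j assume "i < dim_row (X * mat 1 1 (\<lambda>_. c))" "j < dim_col (X * mat 1 1 (\<lambda>_. c))"
      then have ij: "i < d" "j = 0" using X by auto
      have "(Q * X) $$ (i,j) = u $ i" using ij Qc v by (simp add: X_def u_def)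
      also have "\<dots> = (X * mat 1 1 (\<lambda>_. c)) $$ (i,j)"
        using ij v by (simp add: X_def uv scalar_prod_def mat_of_cols_def)
      finally show "(Q * X) $$ (i,j) = (X * mat 1 1 (\<lambda>_. c)) $$ (i,j)" .
    qed (use Qc X in auto)
    ultimately show ?thesis
      using orth_similar_invariant_block(2)[OF Q X _ _ _, of "mat 1 1 (\<lambda>_. c)"] d e by auto
  next
    case False
    have "w \<bullet> w \<ge> 0" by (auto simp: scalar_prod_def intro!: sum_nonneg)
    then have pos: "1 - c\<^sup>2 > 0" using False ww by simp
    define s where "s = sqrt (1 - c\<^sup>2)"
    have s: "s > 0" "s * s = 1 - c\<^sup>2" using pos by (auto simp: s_def)
    define b where "b = (1 / s) \<cdot>\<^sub>v w"
    have b: "b \<in> carrier_vec d" using w by (simp add: b_def)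
    have vb: "v \<bullet> b = 0" "b \<bullet> v = 0" using vw v w by (auto simp: b_def comm_scalar_prod[of w d v])
    have bb: "b \<bullet> b = 1" using w ww s by (simp add: b_def field_simps)
    have ub: "u = c \<cdot>\<^sub>v v + s \<cdot>\<^sub>v b"
      unfolding uw b_def using s v w by (simp add: smult_smult_assoc)
    have Qb: "Q *\<^sub>v b = c \<cdot>\<^sub>v b - s \<cdot>\<^sub>v v"
    proof -
      have "Q *\<^sub>v w = Q *\<^sub>v u - c \<cdot>\<^sub>v u"
        unfolding w_def using Qc u v by (simp add: mult_minus_distrib_mat_vec[of _ d d] mult_mat_vec[of _ d d] u_def)
      also have "\<dots> = c \<cdot>\<^sub>v u - v" unfolding Qu using u v by (intro eq_vecI) (auto simp: algebra_simps)
      finally have "Q *\<^sub>v b = (1 / s) \<cdot>\<^sub>v (c \<cdot>\<^sub>v u - v)"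
        unfolding b_def using Qc w by (simp add: mult_mat_vec[of _ d d])
      also have "\<dots> = c \<cdot>\<^sub>v b - s \<cdot>\<^sub>v v"
      proof (rule eq_vecI)
        fix i assume "i < dim_vec (c \<cdot>\<^sub>v b - s \<cdot>\<^sub>v v)"
        then have i: "i < d" using v by simp
        have "c * (c * v $ i + s * b $ i) - v $ i = c * s * b $ i - (1 - c\<^sup>2) * v $ i"
          by (simp add: algebra_simps power2_eq_square)
        also have "\<dots> = s * (c * b $ i - s * v $ i)"
          unfolding s(2)[symmetric] by (simp add: algebra_simps)
        finally show "((1 / s) \<cdot>\<^sub>v (c \<cdot>\<^sub>v u - v)) $ i = (c \<cdot>\<^sub>v b - s \<cdot>\<^sub>v v) $ i"
          unfolding ub using i b v s by simp
      qed (use b v ub in auto)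
      finally show ?thesis .
    qed
    have "d \<noteq> 1"
    proof
      assume "d = 1"
      then have "v $ 0 * v $ 0 = 1" "b $ 0 * b $ 0 = 1" "v $ 0 * b $ 0 = 0"
        using vv bb vb v b by (auto simp: scalar_prod_def)
      then show False by auto
    qed
    then have d2: "d \<ge> 2" using d by simp
    have "c\<^sup>2 + (- s)\<^sup>2 = 1" using s by (simp add: power2_eq_square)
    then obtain \<phi> where \<phi>: "c = cos \<phi>" "- s = sin \<phi>" by (metis sincos_total_2pi)
    define t where "t = \<phi> / (2 * pi)"
    have t: "cos (2 * pi * t) = c" "sin (2 * pi * t) = - s" using \<phi> by (auto simp: t_def)
    define X where "X = mat_of_cols d [v, b]"
    have X: "X \<in> carrier_mat d 2"
      using mat_of_cols_carrier(1)[of d "[v, b]"] by (simp add: X_def numeral_2_eq_2)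
    have cX: "col X 0 = v" "col X (Suc 0) = b" using v b by (auto simp: X_def)
    have "transpose_mat X * X = 1\<^sub>m 2"
      using vv bb vb X by (intro eq_matI) (auto simp: less_2_cases_iff cX)
    moreover have "Q * X = X * rotation_block t"
    proof (rule eq_matI)
      fix i j assume "i < dim_row (X * rotation_block t)" "j < dim_col (X * rotation_block t)"
      then have ij: "i < d" "j < 2" using X rotation_block_carrier[of t] by auto
      have Xi: "X $$ (i,0) = v $ i" "X $$ (i,Suc 0) = b $ i"
        using ij by (auto simp: X_def mat_of_cols_def)
      have "(Q * X) $$ (i,j) = (Q *\<^sub>v col X j) $ i" using ij Qc X by simp
      also have "\<dots> = X $$ (i,0) * rotation_block t $$ (0,j) + X $$ (i,Suc 0) * rotation_block t $$ (Suc 0,j)"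
        using ij less_2_cases[of j] b v
        by (auto simp: cX Qb ub u_def[symmetric] rotation_block_index t Xi simp del: index_mult_mat_vec)
      also have "\<dots> = (X * rotation_block t) $$ (i,j)"
        using ij X rotation_block_carrier[of t]
        by (auto simp: scalar_prod_def numeral_2_eq_2)
      finally show "(Q * X) $$ (i,j) = (X * rotation_block t) $$ (i,j)" .
    qed (use Qc X in auto)
    ultimately have "\<exists>Q' \<in> carrier (orth_group (d - 2)). orth_similar d Q (block_sum (rotation_block t) Q')"
      by (intro orth_similar_invariant_block(2)[OF Q X _ d2 rotation_block_carrier])
    then show ?thesis using d2 by blast
  qed
qed

lemma orth_similar_block_sum_swap:
  assumes A: "A \<in> carrier_mat a a" and B: "B \<in> carrier_mat b b" and C: "C \<in> carrier_mat c c"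
  shows "orth_similar (a + (b + c)) (block_sum A (block_sum B C)) (block_sum B (block_sum A C))"
  using orth_similar_block_sum[OF orth_similar_block_sum_commute[OF A B] orth_similar_refl[OF C]]
  by (simp add: block_sum_assoc add.assoc)

lemma rotation_block_scalar:
  assumes "e \<in> {1,-1}"
  shows "block_sum (mat 1 1 (\<lambda>_. e)) (mat 1 1 (\<lambda>_. e)) = rotation_block (if e = 1 then 0 else 1/2)"
proof (rule eq_matI)
  fix i j
  assume "i < dim_row (rotation_block (if e = 1 then 0 else 1/2))"
    "j < dim_col (rotation_block (if e = 1 then 0 else 1/2))"
  then have "i = 0 \<or> i = Suc 0" "j = 0 \<or> j = Suc 0"
    by (simp_all add: less_2_cases_iff)
  then show "block_sum (mat 1 1 (\<lambda>_. e)) (mat 1 1 (\<lambda>_. e)) $$ (i,j)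
      = rotation_block (if e = 1 then 0 else 1/2) $$ (i,j)"
    using assms by (elim disjE) (auto simp: block_sum_def rotation_block_index)
qed (auto simp: block_sum_def rotation_block_def mat_of_rows_list_def)

definition rotation_summand :: "nat \<Rightarrow> real mat \<Rightarrow> bool" where
  "rotation_summand d Q \<longleftrightarrow> d \<ge> 2 \<and>
     (\<exists>t Q'. Q' \<in> carrier (orth_group (d - 2)) \<and> orth_similar d Q (block_sum (rotation_block t) Q'))"

lemma rotation_summand_similar:
  assumes "orth_similar d Q Q'" "rotation_summand d Q'"
  shows "rotation_summand d Q"
  using assms orth_similar_trans unfolding rotation_summand_def by blast

lemma rotation_summand_block_sum:
  assumes A: "A \<in> carrier (orth_group a)" and Q: "rotation_summand d Q"
  shows "rotation_summand (a + d) (block_sum A Q)"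
proof -
  obtain t Q' where d: "d \<ge> 2" and Q': "Q' \<in> carrier (orth_group (d - 2))"
    and sim: "orth_similar d Q (block_sum (rotation_block t) Q')"
    using Q by (auto simp: rotation_summand_def)
  have e: "a + (2 + (d - 2)) = a + d" using d by simp
  have c: "A \<in> carrier_mat a a" "Q' \<in> carrier_mat (d - 2) (d - 2)" using A Q' by (auto simp: orth_group_iff)
  have "orth_similar (a + d) (block_sum A Q) (block_sum A (block_sum (rotation_block t) Q'))"
    by (intro orth_similar_block_sum orth_similar_refl c sim)
  also have "orth_similar (a + d) \<dots> (block_sum (rotation_block t) (block_sum A Q'))"
    using orth_similar_block_sum_swap[OF c(1) rotation_block_carrier c(2), of t] unfolding e .
  finally show ?thesis using orth_block_sum[OF A Q'] d by (auto simp: rotation_summand_def)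
qed

lemma orth_scalar:
  assumes "e \<in> {1,-1}"
  shows "mat 1 1 (\<lambda>_. e) \<in> carrier (orth_group 1)"
  unfolding orth_group_iff using assms by (auto intro!: eq_matI simp: scalar_prod_def)

lemma rotation_summand_double:
  assumes "e \<in> {1,-1}" "Q \<in> carrier (orth_group d)"
  shows "rotation_summand (1 + (1 + d)) (block_sum (mat 1 1 (\<lambda>_. e)) (block_sum (mat 1 1 (\<lambda>_. e)) Q))"
proof -
  have "Q \<in> carrier_mat d d" using assms(2) by (simp add: orth_group_iff)
  from block_sum_carrier[OF rotation_block_carrier this]
  have "orth_similar (2 + d) (block_sum (rotation_block (if e = 1 then 0 else 1/2)) Q)
      (block_sum (rotation_block (if e = 1 then 0 else 1/2)) Q)" by (rule orth_similar_refl)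
  then show ?thesis
    unfolding block_sum_assoc rotation_block_scalar[OF assms(1)] rotation_summand_def
    using assms(2)
    by (intro conjI exI[of _ "if e = 1 then 0 else 1/2"] exI[of _ Q]) auto
qed

lemma rotation_summand_exists:
  assumes Q: "Q \<in> carrier (orth_group d)" and d: "d \<ge> 3"
  shows "rotation_summand d Q"
proof -
  let ?s = "\<lambda>e. mat 1 1 (\<lambda>_. e) :: real mat"
  have peel: "(\<exists>e Q'. e \<in> {1,-1} \<and> Q' \<in> carrier (orth_group n) \<and>
      orth_similar (1 + n) Q (block_sum (?s e) Q')) \<or> rotation_summand (1 + n) Q"
    if "Q \<in> carrier (orth_group (1 + n))" for n Q
    using orth_similar_peel[OF that] by (auto simp: rotation_summand_def)
  obtain n where "d = 3 + n" using d le_Suc_ex by blast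
  then have n: "d = 1 + (1 + (1 + n))" by simp
  have Q: "Q \<in> carrier (orth_group (1 + (1 + (1 + n))))" using Q n by simp
  have "rotation_summand (1 + (1 + (1 + n))) Q"
    using peel[OF Q]
  proof (elim disjE exE conjE)
    fix e1 Q1
    assume e1: "e1 \<in> {1,-1::real}" and Q1: "Q1 \<in> carrier (orth_group (1 + (1 + n)))"
      and s1: "orth_similar (1 + (1 + (1 + n))) Q (block_sum (?s e1) Q1)"
    have "rotation_summand (1 + (1 + (1 + n))) (block_sum (?s e1) Q1)"
      using peel[OF Q1]
    proof (elim disjE[where Q = "rotation_summand _ _"] exE conjE)
      fix e2 Q2
      assume e2: "e2 \<in> {1,-1::real}" and Q2: "Q2 \<in> carrier (orth_group (1 + n))"
        and s2: "orth_similar (1 + (1 + n)) Q1 (block_sum (?s e2) Q2)"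
      have s2': "orth_similar (1 + (1 + (1 + n))) (block_sum (?s e1) Q1) (block_sum (?s e1) (block_sum (?s e2) Q2))"
        by (intro orth_similar_block_sum s2 orth_similar_refl) auto
      have Q2c: "Q2 \<in> carrier_mat (1 + n) (1 + n)" using Q2 by (simp add: orth_group_iff)
      have "rotation_summand (1 + (1 + (1 + n))) (block_sum (?s e1) (block_sum (?s e2) Q2))"
      proof (cases "e1 = e2")
        case True
        then show ?thesis using rotation_summand_double[OF e2 Q2] by simp
      next
        case False
        show ?thesis using peel[OF Q2]
        proof (elim disjE[where Q = "rotation_summand _ _"] exE conjE)
          fix e3 Q3
          assume e3: "e3 \<in> {1,-1::real}" and Q3: "Q3 \<in> carrier (orth_group n)"
            and s3: "orth_similar (1 + n) Q2 (block_sum (?s e3) Q3)"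
          have Q3c: "Q3 \<in> carrier_mat n n" using Q3 by (simp add: orth_group_iff)
          have o: "block_sum (?s e) Q3 \<in> carrier (orth_group (1 + n))" if "e \<in> {1,-1}" for e
            using orth_block_sum[OF orth_scalar[OF that] Q3] .
          have c: "block_sum (?s e) Q3 \<in> carrier_mat (1 + n) (1 + n)" for e
            by (intro block_sum_carrier Q3c) auto
          have t: "rotation_summand (1 + (1 + n)) (block_sum (?s e) Q2)" if "e = e3" "e \<in> {1,-1}" for e
          proof (rule rotation_summand_similar)
            show "orth_similar (1 + (1 + n)) (block_sum (?s e) Q2) (block_sum (?s e) (block_sum (?s e3) Q3))"
              by (intro orth_similar_block_sum s3 orth_similar_refl) auto
            show "rotation_summand (1 + (1 + n)) (block_sum (?s e) (block_sum (?s e3) Q3))"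
              unfolding that(1) by (rule rotation_summand_double[OF e3 Q3])
          qed
          show ?thesis
          proof (cases "e2 = e3")
            case True
            show ?thesis by (rule rotation_summand_block_sum[OF orth_scalar[OF e1] t[OF True e2]])
          next
            case False
            then have "e1 = e3" using \<open>e1 \<noteq> e2\<close> e1 e2 e3 by auto
            from rotation_summand_block_sum[OF orth_scalar[OF e2] t[OF this e1]]
            show ?thesis
              by (rule rotation_summand_similar[rotated])
                (intro orth_similar_block_sum_swap Q2c; simp)
          qed
        qed (intro rotation_summand_block_sum orth_scalar e1 e2)
      qed
      with s2' show ?thesis by (rule rotation_summand_similar)
    qed (intro rotation_summand_block_sum orth_scalar e1)
    with s1 show ?thesis by (rule rotation_summand_similar)
  qed
  then show ?thesis using n by simp
qed

lemma block_rotation_Cons: "block_rotation (t # ts) e = block_sum (rotation_block t) (block_rotation ts e)"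
  by (simp add: block_rotation_def diag_block_mat_Cons del: diag_block_mat.simps(2))

lemma block_rotation_Nil: "block_rotation [] e = mat 1 1 (\<lambda>_. e)"
  by (simp add: block_rotation_def del: diag_block_mat.simps(2))

lemma block_rotation_carrier:
  "block_rotation ts e \<in> carrier_mat (2 * length ts + 1) (2 * length ts + 1)"
proof (induction ts)
  case (Cons t ts)
  show ?case using block_sum_carrier[OF rotation_block_carrier[of t] Cons] by (simp add: block_rotation_Cons)
qed (simp add: block_rotation_Nil)

lemma orth_rotation_block: "rotation_block t \<in> carrier (orth_group 2)"
proof -
  have "transpose_mat (rotation_block t) * rotation_block t = 1\<^sub>m 2"
  proof (rule eq_matI)
    fix i j assume "i < dim_row (1\<^sub>m 2 :: real mat)" "j < dim_col (1\<^sub>m 2 :: real mat)"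
    then have ij: "i < 2" "j < 2" by auto
    have "(transpose_mat (rotation_block t) * rotation_block t) $$ (i,j) =
        rotation_block t $$ (0,i) * rotation_block t $$ (0,j) +
        rotation_block t $$ (Suc 0,i) * rotation_block t $$ (Suc 0,j)"
      using ij by (simp add: scalar_prod_def numeral_2_eq_2)
    also have "\<dots> = 1\<^sub>m 2 $$ (i,j)"
      using ij sin_cos_squared_add3[of "2 * pi * t"]
      by (auto simp: less_2_cases_iff rotation_block_index add.commute)
    finally show "(transpose_mat (rotation_block t) * rotation_block t) $$ (i,j) = 1\<^sub>m 2 $$ (i,j)" .
  qed auto
  then show ?thesis by (simp add: orth_group_iff)
qed

lemma orth_block_rotation:
  assumes "e \<in> {1,-1}"
  shows "block_rotation ts e \<in> carrier (orth_group (2 * length ts + 1))"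
proof (induction ts)
  case (Cons t ts)
  then show ?case using orth_block_sum[OF orth_rotation_block Cons.IH, of t] by (simp add: block_rotation_Cons)
qed (use orth_scalar[OF assms] in \<open>simp add: block_rotation_Nil\<close>)

lemma orth_similar_block_rotation:
  assumes "Q \<in> carrier (orth_group (2 * n + 1))"
  shows "\<exists>ts e. length ts = n \<and> e \<in> {1,-1} \<and> orth_similar (2 * n + 1) Q (block_rotation ts e)"
  using assms
proof (induction n arbitrary: Q)
  case 0
  then have Q: "Q \<in> carrier (orth_group 1)" by simp
  from orth_similar_peel[OF this] obtain e Q' where e: "e \<in> {1,-1}"
    and Q': "Q' \<in> carrier (orth_group 0)" and s: "orth_similar 1 Q (block_sum (mat 1 1 (\<lambda>_. e)) Q')" by auto
  have "block_sum (mat 1 1 (\<lambda>_. e)) Q' = block_rotation [] e"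
    using Q' by (intro eq_matI) (auto simp: block_sum_def block_rotation_Nil orth_group_iff)
  then show ?case using s e by auto
next
  case (Suc n)
  have "rotation_summand (2 * Suc n + 1) Q" using Suc.prems by (intro rotation_summand_exists) auto
  then obtain t Q' where Q': "Q' \<in> carrier (orth_group (2 * n + 1))"
    and s: "orth_similar (2 * Suc n + 1) Q (block_sum (rotation_block t) Q')"
    by (auto simp: rotation_summand_def)
  from Suc.IH[OF Q'] obtain ts e where te: "length ts = n" "e \<in> {1,-1}"
    "orth_similar (2 * n + 1) Q' (block_rotation ts e)" by auto
  have d: "2 * Suc n + 1 = 2 + (2 * n + 1)" by simp
  note s[unfolded d]
  also have "orth_similar (2 + (2 * n + 1)) (block_sum (rotation_block t) Q') (block_rotation (t # ts) e)"
    unfolding block_rotation_Cons by (intro orth_similar_block_sum orth_similar_refl te) simp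
  finally show ?case unfolding d using te(1,2) by (metis length_Cons)
qed

lemma orth_similar_block_rotation_insort:
  "orth_similar (2 + (2 * length ts + 1)) (block_rotation (t # ts) e) (block_rotation (insort t ts) e)"
proof (induction ts)
  case Nil
  show ?case using orth_similar_refl[OF block_rotation_carrier[of "[t]" e]] by simp
next
  case (Cons u ts)
  have len: "2 + (2 * length (u # ts) + 1) = 2 + (2 + (2 * length ts + 1))" by simp
  show ?case
  proof (cases "t \<le> u")
    case True
    then show ?thesis using orth_similar_refl[OF block_rotation_carrier[of "t # u # ts" e]] by simp
  next
    case False
    have "orth_similar (2 + (2 + (2 * length ts + 1))) (block_rotation (t # u # ts) e) (block_rotation (u # t # ts) e)"
      unfolding block_rotation_Cons by (intro orth_similar_block_sum_swap rotation_block_carrier block_rotation_carrier)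
    also have "orth_similar (2 + (2 + (2 * length ts + 1))) \<dots> (block_rotation (u # insort t ts) e)"
      unfolding block_rotation_Cons[of u]
      by (intro orth_similar_block_sum orth_similar_refl rotation_block_carrier Cons)
    also have "u # insort t ts = insort t (u # ts)" using False by simp
    finally show ?thesis unfolding len .
  qed
qed

lemma orth_similar_block_rotation_sort:
  "orth_similar (2 * length ts + 1) (block_rotation ts e) (block_rotation (sort ts) e)"
proof (induction ts)
  case Nil
  show ?case using orth_similar_refl[OF block_rotation_carrier[of "[]" e]] by simp
next
  case (Cons t ts)
  have len: "2 * length (t # ts) + 1 = 2 + (2 * length ts + 1)" by simp
  have "orth_similar (2 + (2 * length ts + 1)) (block_rotation (t # ts) e) (block_rotation (t # sort ts) e)"
    unfolding block_rotation_Cons by (intro orth_similar_block_sum orth_similar_refl rotation_block_carrier Cons)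
  also have "orth_similar (2 + (2 * length ts + 1)) \<dots> (block_rotation (insort t (sort ts)) e)"
    using orth_similar_block_rotation_insort[of "sort ts" t e] unfolding length_sort .
  also have "insort t (sort ts) = sort (t # ts)" by simp
  finally show ?case unfolding len .
qed

lemma reduced_angle:
  "reduced_angle t \<in> {0..1/2}"
  "cos (2 * pi * reduced_angle t) = cos (2 * pi * t)"
  "sin (2 * pi * reduced_angle t) = sin (2 * pi * t) \<or> sin (2 * pi * reduced_angle t) = - sin (2 * pi * t)"
proof -
  define r where "r = reduced_angle t"
  have r: "r \<in> {0..1/2} \<and> ([r = t] (rmod 1) \<or> [r = - t] (rmod 1))"
    unfolding r_def reduced_angle_def by (rule theI'[OF ex1_reduced_angle])
  then show "reduced_angle t \<in> {0..1/2}" by (simp add: r_def)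
  obtain k :: int where "t = r + k \<or> - t = r + k" using r by (auto simp: rcong_altdef)
  then have "2 * pi * t = 2 * pi * r + 2 * pi * k \<or> 2 * pi * t = - (2 * pi * r + 2 * pi * k)"
  proof
    assume "- t = r + k"
    then have "t = - (r + k)" by simp
    then have "2 * pi * t = - (2 * pi * r + 2 * pi * k)" by (simp only: distrib_left minus_add mult_minus_right)
    then show ?thesis ..
  qed (simp add: algebra_simps)
  moreover have "cos (2 * pi * r + 2 * pi * k) = cos (2 * pi * r)" "sin (2 * pi * r + 2 * pi * k) = sin (2 * pi * r)"
    by (simp_all add: cos_add sin_add)
  ultimately have "cos (2 * pi * t) = cos (2 * pi * r) \<and>
      (sin (2 * pi * t) = sin (2 * pi * r) \<or> sin (2 * pi * t) = - sin (2 * pi * r))"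
    by (elim disjE) (simp_all only: cos_minus sin_minus, simp_all)
  then show "cos (2 * pi * reduced_angle t) = cos (2 * pi * t)"
    "sin (2 * pi * reduced_angle t) = sin (2 * pi * t) \<or> sin (2 * pi * reduced_angle t) = - sin (2 * pi * t)"
    unfolding r_def by auto
qed

lemma reduced_angle_eqI:
  assumes "t \<in> {0..1/2}"
  shows "reduced_angle t = t"
  unfolding reduced_angle_def using assms by (intro the1_equality ex1_reduced_angle) auto

lemma orth_similar_reduced_angle: "orth_similar 2 (rotation_block t) (rotation_block (reduced_angle t))"
  using reduced_angle(3)[of t]
proof
  assume s: "sin (2 * pi * reduced_angle t) = sin (2 * pi * t)"
  have "rotation_block (reduced_angle t) = rotation_block t"
    unfolding rotation_block_def reduced_angle(2) s ..
  then show ?thesis by (simp add: orth_similar_refl)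
next
  assume s: "sin (2 * pi * reduced_angle t) = - sin (2 * pi * t)"
  define P :: "real mat" where "P = mat 2 2 (\<lambda>(i,j). if i = j then 0 else 1)"
  have P: "P \<in> carrier (orth_group 2)" unfolding orth_group_iff
    by (auto simp: P_def scalar_prod_def numeral_2_eq_2 less_Suc_eq intro!: eq_matI)
  have "rotation_block t * P = P * rotation_block (reduced_angle t)"
  proof (rule eq_matI)
    fix i j assume "i < dim_row (P * rotation_block (reduced_angle t))"
      "j < dim_col (P * rotation_block (reduced_angle t))"
    then have ij: "i < 2" "j < 2" by (auto simp: P_def)
    have "(rotation_block t * P) $$ (i,j) =
        rotation_block t $$ (i,0) * P $$ (0,j) + rotation_block t $$ (i,Suc 0) * P $$ (Suc 0,j)"
      using ij by (simp add: P_def scalar_prod_def numeral_2_eq_2)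
    also have "\<dots> = P $$ (i,0) * rotation_block (reduced_angle t) $$ (0,j)
        + P $$ (i,Suc 0) * rotation_block (reduced_angle t) $$ (Suc 0,j)"
      using ij s by (auto simp: P_def less_2_cases_iff rotation_block_index reduced_angle(2))
    also have "\<dots> = (P * rotation_block (reduced_angle t)) $$ (i,j)"
      using ij by (simp add: P_def scalar_prod_def numeral_2_eq_2)
    finally show "(rotation_block t * P) $$ (i,j) = (P * rotation_block (reduced_angle t)) $$ (i,j)" .
  qed (simp_all add: P_def)
  then show ?thesis using P by (auto simp: orth_similar_def)
qed

lemma orth_similar_block_rotation_reduced:
  "orth_similar (2 * length ts + 1) (block_rotation ts e) (block_rotation (map reduced_angle ts) e)"
proof (induction ts)
  case Nil
  show ?case using orth_similar_refl[OF block_rotation_carrier[of "[]" e]] by simp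
next
  case (Cons t ts)
  have "orth_similar (2 + (2 * length ts + 1)) (block_rotation (t # ts) e)
      (block_rotation (reduced_angle t # map reduced_angle ts) e)"
    unfolding block_rotation_Cons by (intro orth_similar_block_sum orth_similar_reduced_angle Cons)
  then show ?case by simp
qed

section \<open>Invariants of the normal form\<close>

lemma det_shift_block_sum:
  fixes A B :: "real mat"
  assumes "A \<in> carrier_mat a a" "B \<in> carrier_mat b b"
  shows "det (x \<cdot>\<^sub>m 1\<^sub>m (a + b) + block_sum A B) = det (x \<cdot>\<^sub>m 1\<^sub>m a + A) * det (x \<cdot>\<^sub>m 1\<^sub>m b + B)"
proof -
  have "x \<cdot>\<^sub>m 1\<^sub>m (a + b) + block_sum A B = block_sum (x \<cdot>\<^sub>m 1\<^sub>m a + A) (x \<cdot>\<^sub>m 1\<^sub>m b + B)"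
    using assms by (intro eq_matI) (auto simp: block_sum_def)
  then show ?thesis using assms block_sum_det[of "x \<cdot>\<^sub>m 1\<^sub>m a + A" a "x \<cdot>\<^sub>m 1\<^sub>m b + B" b]
    by simp
qed

lemma det_2x2:
  fixes M :: "'a::idom mat"
  assumes "M \<in> carrier_mat 2 2"
  shows "det M = M $$ (0,0) * M $$ (1,1) - M $$ (0,1) * M $$ (1,0)"
proof -
  let ?e = "\<lambda>i j. mat 1 1 (\<lambda>_. M $$ (i,j))"
  have M: "M = four_block_mat (?e 0 0) (?e 0 1) (?e 1 0) (?e 1 1)"
    using assms by (intro eq_matI) (auto simp: numeral_2_eq_2 less_Suc_eq)
  have prod: "?e 0 0 * ?e 1 1 - ?e 0 1 * ?e 1 0
      = mat 1 1 (\<lambda>_. M $$ (0,0) * M $$ (1,1) - M $$ (0,1) * M $$ (1,0))"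
    by (intro eq_matI) (simp_all add: scalar_prod_def)
  have "det M = det (four_block_mat (?e 0 0) (?e 0 1) (?e 1 0) (?e 1 1))"
    by (rule arg_cong[OF M])
  also have "\<dots> = det (?e 0 0 * ?e 1 1 - ?e 0 1 * ?e 1 0)"
    by (rule det_four_block_mat[of _ 1]) (auto intro!: eq_matI simp: scalar_prod_def)
  also have "\<dots> = M $$ (0,0) * M $$ (1,1) - M $$ (0,1) * M $$ (1,0)"
    unfolding prod by (subst det_single[OF mat_carrier]) simp
  finally show ?thesis .
qed

lemma det_shift_rotation_block:
  "det (x \<cdot>\<^sub>m 1\<^sub>m 2 + rotation_block t) = x\<^sup>2 + 2 * cos (2 * pi * t) * x + 1"
proof -
  define M where "M = x \<cdot>\<^sub>m 1\<^sub>m 2 + rotation_block t"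
  have M: "M \<in> carrier_mat 2 2" by (simp add: M_def)
  have "det M = M $$ (0,0) * M $$ (1,1) - M $$ (0,1) * M $$ (1,0)" by (rule det_2x2[OF M])
  also have "\<dots> =
      (x + cos (2 * pi * t)) * (x + cos (2 * pi * t)) + sin (2 * pi * t) * sin (2 * pi * t)"
    by (simp add: M_def rotation_block_index)
  finally show ?thesis using sin_cos_squared_add3[of "2 * pi * t"]
    by (simp add: M_def algebra_simps power2_eq_square)
qed

lemma det_shift_block_rotation:
  "det (x \<cdot>\<^sub>m 1\<^sub>m (2 * length ts + 1) + block_rotation ts e)
     = (\<Prod>t\<leftarrow>ts. x\<^sup>2 + 2 * cos (2 * pi * t) * x + 1) * (x + e)"
proof (induction ts)
  case Nil
  show ?case by (subst det_single) (simp_all add: block_rotation_Nil)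
next
  case (Cons t ts)
  have "2 * length (t # ts) + 1 = 2 + (2 * length ts + 1)" by simp
  then show ?case
    using det_shift_block_sum[OF rotation_block_carrier block_rotation_carrier] Cons
    unfolding block_rotation_Cons by (simp add: det_shift_rotation_block)
qed

lemma det_block_rotation: "det (block_rotation ts e) = e"
proof -
  have "0 \<cdot>\<^sub>m 1\<^sub>m (2 * length ts + 1) + block_rotation ts e = block_rotation ts e"
    using block_rotation_carrier[of ts e] by (intro eq_matI) auto
  then show ?thesis using det_shift_block_rotation[of 0 ts e] by (simp add: map_replicate_const)
qed

text \<open>For \<open>y = - (x + 1/x) / 2\<close> the factor \<open>x\<^sup>2 + 2 c x + 1\<close> is \<open>- 2 x (y - c)\<close>, which turns equality
  of the characteristic polynomials into equality of monic polynomials with roots \<open>c\<close>.\<close>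

lemma block_rotation_cos_unique:
  assumes sim: "orth_similar (2 * n + 1) (block_rotation ts e) (block_rotation us e)"
    and len: "length ts = n" "length us = n" and e: "e \<in> {1,-1}"
  shows "image_mset (\<lambda>t. cos (2 * pi * t)) (mset ts) = image_mset (\<lambda>t. cos (2 * pi * t)) (mset us)"
proof -
  define p :: "real list \<Rightarrow> real poly" where "p = (\<lambda>ts. \<Prod>t\<leftarrow>ts. [:- cos (2 * pi * t), 1:])"
  have proots_p: "proots (p ts) = image_mset (\<lambda>t. cos (2 * pi * t)) (mset ts)" and p0: "p ts \<noteq> 0" for ts
  proof -
    show "p ts \<noteq> 0" for ts by (auto simp: p_def prod_list_zero_iff)
    then show "proots (p ts) = image_mset (\<lambda>t. cos (2 * pi * t)) (mset ts)"
      by (induction ts) (auto simp: p_def proots_mult simp del: mult_pCons_left)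
  qed
  have "poly (p ts - p us) y = 0" if "y < -1" for y
  proof -
    define x where "x = sqrt (y\<^sup>2 - 1) - y"
    have "y\<^sup>2 > 1" using one_less_power[of "- y" 2] that by simp
    then have s: "sqrt (y\<^sup>2 - 1) * sqrt (y\<^sup>2 - 1) = y\<^sup>2 - 1" "sqrt (y\<^sup>2 - 1) \<ge> 0" by auto
    have x: "x > 1" unfolding x_def using s(2) that by linarith
    have xy: "x\<^sup>2 + 1 = - 2 * x * y" using s(1) by (simp add: x_def power2_eq_square algebra_simps)
    have *: "(\<Prod>t\<leftarrow>ts. x\<^sup>2 + 2 * cos (2 * pi * t) * x + 1) = (- 2 * x) ^ length ts * poly (p ts) y" for ts
    proof (induction ts)
      case (Cons t ts)
      have "x\<^sup>2 + 2 * cos (2 * pi * t) * x + 1 = (- 2 * x) * (y - cos (2 * pi * t))"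
        using xy by (simp add: algebra_simps)
      then have "(\<Prod>t\<leftarrow>t # ts. x\<^sup>2 + 2 * cos (2 * pi * t) * x + 1) =
          ((- 2 * x) * (y - cos (2 * pi * t))) * ((- 2 * x) ^ length ts * poly (p ts) y)"
        using Cons by simp
      also have "\<dots> = (- 2 * x) ^ length (t # ts) * ((y - cos (2 * pi * t)) * poly (p ts) y)" by simp
      also have "(y - cos (2 * pi * t)) * poly (p ts) y = poly (p (t # ts)) y"
        by (simp add: p_def algebra_simps)
      finally show ?case .
    qed (simp add: p_def)
    have "x + e \<noteq> 0" using x e by auto
    then have "poly (p ts) y = poly (p us) y"
      using orth_similar_det[OF sim, of x] det_shift_block_rotation[of x ts e]
        det_shift_block_rotation[of x us e] len x
      by (simp add: *)
    then show ?thesis by simp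
  qed
  then have "{..<-1} \<subseteq> {y. poly (p ts - p us) y = 0}" by auto
  then have "p ts - p us = 0"
    using poly_roots_finite[of "p ts - p us"] infinite_Iio[of "-1::real"] finite_subset by blast
  then show ?thesis using proots_p by (metis eq_iff_diff_eq_0)
qed

lemma reduced_angle_arccos: "reduced_angle t = arccos (cos (2 * pi * t)) / (2 * pi)"
proof -
  have "arccos (cos (2 * pi * reduced_angle t)) = 2 * pi * reduced_angle t"
    using reduced_angle(1)[of t] by (intro arccos_cos) auto
  then show ?thesis by (simp add: reduced_angle(2))
qed

lemma block_rotation_unique:
  assumes sim: "orth_similar d (block_rotation ts e) (block_rotation us f)"
    and ef: "e \<in> {1,-1}" 
  shows "e = f" "length us = length ts" "mset (map reduced_angle us) = mset (map reduced_angle ts)"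
proof -
  have len: "d = 2 * length ts + 1" "d = 2 * length us + 1"
    using sim block_rotation_carrier[of ts e] block_rotation_carrier[of us f]
    by (auto simp: orth_similar_def)
  then show l: "length us = length ts" by simp
  show ef': "e = f"
    using orth_similar_det[OF sim, of 0] det_shift_block_rotation[of 0 ts e]
      det_shift_block_rotation[of 0 us f] len by (simp add: map_replicate_const)
  have "image_mset (\<lambda>t. cos (2 * pi * t)) (mset us) = image_mset (\<lambda>t. cos (2 * pi * t)) (mset ts)"
    using block_rotation_cos_unique[of "length ts" ts e us] sim l len ef ef' by simp
  then have "image_mset (\<lambda>c. arccos c / (2 * pi)) (image_mset (\<lambda>t. cos (2 * pi * t)) (mset us)) =
     image_mset (\<lambda>c. arccos c / (2 * pi)) (image_mset (\<lambda>t. cos (2 * pi * t)) (mset ts))" by simp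
  then show "mset (map reduced_angle us) = mset (map reduced_angle ts)"
    by (simp add: reduced_angle_arccos[abs_def] multiset.map_comp comp_def)
qed

lemma rotation_block_mult: "rotation_block a * rotation_block b = rotation_block (a + b)"
proof (rule eq_matI)
  fix i j assume "i < dim_row (rotation_block (a + b))" "j < dim_col (rotation_block (a + b))"
  then have ij: "i < 2" "j < 2" by auto
  have "(rotation_block a * rotation_block b) $$ (i,j) =
      rotation_block a $$ (i,0) * rotation_block b $$ (0,j) +
      rotation_block a $$ (i,Suc 0) * rotation_block b $$ (Suc 0,j)"
    using ij by (simp add: scalar_prod_def numeral_2_eq_2)
  also have "\<dots> = rotation_block (a + b) $$ (i,j)"
    using ij by (auto simp: less_2_cases_iff rotation_block_index distrib_left cos_add sin_add algebra_simps)
  finally show "(rotation_block a * rotation_block b) $$ (i,j) = rotation_block (a + b) $$ (i,j)" .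
qed auto

lemma rotation_block_eq_one_iff: "rotation_block t = 1\<^sub>m 2 \<longleftrightarrow> t \<in> \<int>"
proof
  assume "rotation_block t = 1\<^sub>m 2"
  then have "cos (2 * pi * t) = 1" using rotation_block_index(1)[of t] by simp
  then obtain k :: int where "2 * pi * t = real_of_int k * 2 * pi" by (auto simp: cos_one_2pi_int)
  then show "t \<in> \<int>" by simp
next
  assume "t \<in> \<int>"
  then obtain k :: int where "t = k" by (auto elim: Ints_cases)
  then show "rotation_block t = 1\<^sub>m 2"
    by (intro eq_matI) (auto simp: less_2_cases_iff rotation_block_index)
qed

lemma rotation_block_pow: "rotation_block t ^\<^sub>m k = rotation_block (real k * t)"
proof (induction k)
  case 0
  show ?case using rotation_block_eq_one_iff[of 0] by simp
qed (simp add: rotation_block_mult algebra_simps)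

lemma block_sum_pow:
  fixes A B :: "real mat"
  assumes "A \<in> carrier_mat a a" "B \<in> carrier_mat b b"
  shows "block_sum A B ^\<^sub>m k = block_sum (A ^\<^sub>m k) (B ^\<^sub>m k)"
  using pow_four_block_mat[OF assms, of k] assms by (simp add: block_sum_def)

lemma block_rotation_pow_eq_one_iff:
  "block_rotation ts e ^\<^sub>m k = 1\<^sub>m (2 * length ts + 1) \<longleftrightarrow> e ^ k = 1 \<and> (\<forall>t \<in> set ts. real k * t \<in> \<int>)"
proof (induction ts)
  case Nil
  have "mat 1 1 (\<lambda>_. e) ^\<^sub>m k = mat 1 1 (\<lambda>_. e ^ k)"
    by (induction k) (auto intro!: eq_matI simp: scalar_prod_def)
  moreover have "mat 1 1 (\<lambda>_. e ^ k) = 1\<^sub>m 1 \<longleftrightarrow> e ^ k = 1"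
    by (auto simp: mat_eq_iff)
  ultimately show ?case by (simp add: block_rotation_Nil)
next
  case (Cons t ts)
  have "block_rotation (t # ts) e ^\<^sub>m k = block_sum (rotation_block (real k * t)) (block_rotation ts e ^\<^sub>m k)"
    unfolding block_rotation_Cons block_sum_pow[OF rotation_block_carrier block_rotation_carrier]
      rotation_block_pow ..
  moreover have "1\<^sub>m (2 * length (t # ts) + 1) = block_sum (1\<^sub>m 2) (1\<^sub>m (2 * length ts + 1) :: real mat)"
    unfolding block_sum_one by simp
  ultimately have "block_rotation (t # ts) e ^\<^sub>m k = 1\<^sub>m (2 * length (t # ts) + 1) \<longleftrightarrow>
      rotation_block (real k * t) = 1\<^sub>m 2 \<and> block_rotation ts e ^\<^sub>m k = 1\<^sub>m (2 * length ts + 1)"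
    using block_sum_eqD[of "rotation_block (real k * t)" "block_rotation ts e ^\<^sub>m k" "1\<^sub>m 2" "1\<^sub>m (2 * length ts + 1)"]
    by auto
  then show ?case unfolding Cons rotation_block_eq_one_iff by auto
qed

section \<open>Counting multisets by support\<close>

lemma finite_card_multisets_with_support:
  assumes "finite T" "T \<noteq> {}"
  shows "finite {M. set_mset M = T \<and> size M = Suc n} \<and>
    card {M. set_mset M = T \<and> size M = Suc n} = n choose (card T - 1)"
  using assms
proof (induction n arbitrary: T)
  case 0
  show ?case
  proof (cases "card T = 1")
    case True
    then obtain x where "T = {x}" by (rule card_1_singletonE)
    then have "{M. set_mset M = T \<and> size M = Suc 0} = {{#x#}}"
      using size_1_singleton_mset by fastforce
    then show ?thesis using True by simp
  next
    case False
    have "card T \<noteq> 0" using 0 by simp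
    have e: "{M. set_mset M = T \<and> size M = Suc 0} = {}"
      using False by (auto dest!: size_1_singleton_mset[unfolded One_nat_def])
    show ?thesis unfolding e using False \<open>card T \<noteq> 0\<close> by (simp add: binomial_eq_0)
  qed
next
  case (Suc n)
  from Suc.prems obtain x where x: "x \<in> T" by auto
  define S where "S = (\<lambda>T n. {M :: 'a multiset. set_mset M = T \<and> size M = Suc n})"
  let ?A = "add_mset x ` S T n" and ?B = "add_mset x ` S (T - {x}) n"
  have S: "S T (Suc n) = ?A \<union> ?B"
  proof
    show "S T (Suc n) \<subseteq> ?A \<union> ?B"
    proof
      fix M assume M: "M \<in> S T (Suc n)"
      then have "x \<in># M" using x by (auto simp: S_def)
      then obtain M' where M': "M = add_mset x M'" by (meson mset_add)
      then have "M' \<in> S T n \<or> M' \<in> S (T - {x}) n" using M by (cases "x \<in># M'") (auto simp: S_def)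
      then show "M \<in> ?A \<union> ?B" using M' by auto
    qed
    have "insert x T = T" "insert x (T - {x}) = T" using x by auto
    then show "?A \<union> ?B \<subseteq> S T (Suc n)" by (simp add: S_def image_subset_iff)
  qed
  have mem: "M \<in> S T n \<Longrightarrow> x \<in># M" "M \<in> S (T - {x}) n \<Longrightarrow> x \<notin># M" for M
    using x by (simp_all add: S_def)
  have "M \<notin> S (T - {x}) n" if "M \<in> S T n" for M using mem[of M] that by blast
  then have disj: "?A \<inter> ?B = {}" by auto
  have inj: "inj_on (add_mset x) U" for U by (auto simp: inj_on_def)
  have T: "finite (S T n)" "card (S T n) = n choose (card T - 1)"
    using Suc.IH[OF Suc.prems] by (simp_all add: S_def)
  show ?case
  proof (cases "T = {x}")
    case True
    then have "S (T - {x}) n = {}" by (auto simp: S_def)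
    then have "finite (S T (Suc n))" "card (S T (Suc n)) = card (S T n)"
      using T inj by (auto simp: S card_image)
    then show ?thesis using T True by (simp add: S_def)
  next
    case False
    then have ne: "T - {x} \<noteq> {}" using x by auto
    have B: "finite (S (T - {x}) n)" "card (S (T - {x}) n) = n choose (card (T - {x}) - 1)"
      using Suc.IH[OF _ ne] Suc.prems by (simp_all add: S_def)
    have "card (T - {x}) > 0" using ne Suc.prems by (simp add: card_gt_0_iff)
    moreover have "card (T - {x}) = card T - 1" using x by simp
    ultimately have "card T = Suc (Suc (card T - 2))" by linarith
    then obtain c where c: "card T = Suc (Suc c)" ..
    have "card (S T (Suc n)) = card (S T n) + card (S (T - {x}) n)"
      unfolding S using T B disj inj by (subst card_Un_disjoint) (auto simp: card_image)
    also have "\<dots> = Suc n choose (card T - 1)" using T B c \<open>card (T - {x}) = card T - 1\<close> by simp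
    finally show ?thesis using T B S by (simp add: S_def)
  qed
qed

lemma finite_card_multisets_support_size:
  assumes A: "finite A" and n: "n > 0" and s: "s > 0"
  shows "finite {M. size M = n \<and> set_mset M \<subseteq> A \<and> card (set_mset M) = s}" (is "finite ?S")
    and "card {M. size M = n \<and> set_mset M \<subseteq> A \<and> card (set_mset M) = s} =
      (card A choose s) * ((n - 1) choose (s - 1))"
proof -
  define U where "U = {T. T \<subseteq> A \<and> card T = s}"
  have fU: "finite U" using A by (simp add: U_def)
  have S: "?S = (\<Union>T \<in> U. {M. set_mset M = T \<and> size M = n})" by (auto simp: U_def)
  have T: "finite {M. set_mset M = T \<and> size M = n} \<and>
      card {M. set_mset M = T \<and> size M = n} = (n - 1) choose (s - 1)" if "T \<in> U" for T
  proof -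
    have "finite T" "T \<noteq> {}" "card T = s" using that A s finite_subset[of T A] by (auto simp: U_def)
    moreover have "Suc (n - 1) = n" using n by simp
    ultimately show ?thesis using finite_card_multisets_with_support[of T "n - 1"] by simp
  qed
  show "finite ?S" unfolding S using fU T by auto
  have "card ?S = (\<Sum>T\<in>U. card {M. set_mset M = T \<and> size M = n})"
    unfolding S using fU T by (intro card_UN_disjoint) auto
  also have "\<dots> = card U * ((n - 1) choose (s - 1))" using T by simp
  also have "card U = card A choose s" unfolding U_def using n_subsets[OF A] .
  finally show "card ?S = (card A choose s) * ((n - 1) choose (s - 1))" .
qed

section \<open>Conjugacy classes\<close>

lemma conj_class_orth_group:
  assumes x: "x \<in> carrier (orth_group d)"
  shows "conj_class (orth_group d) x = {y. orth_similar d y x}"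
proof -
  have xc: "x \<in> carrier_mat d d" using x by (simp add: orth_group_iff)
  have "conj_class (orth_group d) x = {g * x * transpose_mat g | g. g \<in> carrier (orth_group d)}"
  proof -
    have act: "conj_action (orth_group d) g x = g * x * transpose_mat g" if "g \<in> carrier (orth_group d)" for g
      unfolding conj_action_def using x inv_orth_group[OF that]
      by (simp add: orth_group_def)
    show ?thesis
      unfolding conj_class_def orbit_def Setcompr_eq_image by (intro image_cong refl act)
  qed
  also have "\<dots> = {y. orth_similar d y x}"
  proof (intro equalityI subsetI)
    fix y assume "y \<in> {g * x * transpose_mat g | g. g \<in> carrier (orth_group d)}"
    then obtain g where g: "g \<in> carrier (orth_group d)" and y: "y = g * x * transpose_mat g" by auto
    have gc: "g \<in> carrier_mat d d" "transpose_mat g \<in> carrier_mat d d" using g by (auto simp: orth_group_iff)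
    have "y * g = g * x * (transpose_mat g * g)"
      unfolding y using gc xc by (simp add: assoc_mult_mat[of _ d d _ d _ d])
    also have "\<dots> = g * x" using g gc xc by (simp add: orth_group_iff)
    finally show "y \<in> {y. orth_similar d y x}"
      using g gc xc y by (auto simp: orth_similar_def)
  next
    fix y assume "y \<in> {y. orth_similar d y x}"
    then obtain g where g: "g \<in> carrier (orth_group d)" and y: "y * g = g * x" "y \<in> carrier_mat d d"
      by (auto simp: orth_similar_def)
    have gc: "g \<in> carrier_mat d d" "transpose_mat g \<in> carrier_mat d d" using g by (auto simp: orth_group_iff)
    have "y = y * (g * transpose_mat g)" using orth_mult_transpose[OF g] y by simp
    also have "\<dots> = y * g * transpose_mat g"
      by (rule assoc_mult_mat[symmetric, OF y(2) gc])
    also have "\<dots> = g * x * transpose_mat g" unfolding y(1) ..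
    finally show "y \<in> {g * x * transpose_mat g | g. g \<in> carrier (orth_group d)}" using g by auto
  qed
  finally show ?thesis .
qed

lemma smult_smult_mat: "a \<cdot>\<^sub>m (b \<cdot>\<^sub>m A) = (a * b :: real) \<cdot>\<^sub>m A"
  by (intro eq_matI) auto

lemma one_smult_mat: "(1 :: real) \<cdot>\<^sub>m A = A"
  by (intro eq_matI) auto

lemma special_orth_group_iff:
  "x \<in> carrier (special_orth_group d) \<longleftrightarrow> x \<in> carrier (orth_group d) \<and> det x = 1"
  by (auto simp: special_orth_group_def)

text \<open>In odd dimension \<open>- 1\<close> has determinant \<open>- 1\<close>, so a conjugating matrix may be replaced by its
  negative to make its determinant \<open>1\<close>.\<close>

lemma conj_class_special_orth_group:
  assumes x: "x \<in> carrier (special_orth_group d)" and d: "odd d"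
  shows "conj_class (special_orth_group d) x = conj_class (orth_group d) x"
proof -
  have xO: "x \<in> carrier (orth_group d)" and xc: "x \<in> carrier_mat d d"
    using x by (auto simp: special_orth_group_iff orth_group_iff)
  have act: "conj_action (special_orth_group d) g x = conj_action (orth_group d) g x"
    if "g \<in> carrier (special_orth_group d)" for g
  proof -
    have "inv\<^bsub>special_orth_group d\<^esub> g = inv\<^bsub>orth_group d\<^esub> g"
      using group.m_inv_consistent[OF group_orth_group subgroup_special_orth_group that]
      by (simp add: special_orth_group_def)
    then show ?thesis using x xO by (simp add: conj_action_def special_orth_group_def)
  qed
  show ?thesis
  proof (intro equalityI subsetI)
    fix y assume "y \<in> conj_class (special_orth_group d) x"
    then obtain g where g: "g \<in> carrier (special_orth_group d)" and y: "y = conj_action (special_orth_group d) g x"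
      by (auto simp: conj_class_def orbit_def)
    from g have "g \<in> carrier (orth_group d)" by (simp add: special_orth_group_iff)
    then show "y \<in> conj_class (orth_group d) x"
      unfolding y act[OF g] by (auto simp: conj_class_def orbit_def)
  next
    fix y assume "y \<in> conj_class (orth_group d) x"
    then obtain g where g: "g \<in> carrier (orth_group d)" and y: "y = conj_action (orth_group d) g x"
      by (auto simp: conj_class_def orbit_def)
    have gc: "g \<in> carrier_mat d d" using g by (simp add: orth_group_iff)
    define h where "h = det g \<cdot>\<^sub>m g"
    have dg: "det g * det g = 1" using orth_det[OF g] by auto
    have tg: "transpose_mat h = det g \<cdot>\<^sub>m transpose_mat g"
      by (intro eq_matI) (auto simp: h_def)
    have "transpose_mat h * h = (det g * det g) \<cdot>\<^sub>m (transpose_mat g * g)"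
      unfolding tg unfolding h_def using gc
      by (simp add: mult_smult_assoc_mat[of _ d d _ d] mult_smult_distrib[of _ d d _ d] smult_smult_mat)
    then have hO: "h \<in> carrier (orth_group d)" using g gc dg by (simp add: orth_group_iff h_def one_smult_mat)
    have "det h = det g ^ d * det g" unfolding h_def using gc by (simp add: det_smult)
    also have "\<dots> = 1" using orth_det[OF g] d by auto
    finally have h: "h \<in> carrier (special_orth_group d)" using hO by (simp add: special_orth_group_iff)
    have "conj_action (orth_group d) h x = h * x * transpose_mat h"
      unfolding conj_action_def using xO inv_orth_group[OF hO] by (simp add: orth_group_def)
    also have "\<dots> = (det g * det g) \<cdot>\<^sub>m (g * x * transpose_mat g)"
      unfolding tg unfolding h_def using gc xc
      by (simp add: mult_smult_assoc_mat[of _ d d _ d] mult_smult_distrib[of _ d d _ d] smult_smult_mat)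
    also have "\<dots> = g * x * transpose_mat g" unfolding dg one_smult_mat ..
    also have "\<dots> = y"
      unfolding y conj_action_def using xO inv_orth_group[OF g] by (simp add: orth_group_def)
    finally have "y = conj_action (special_orth_group d) h x" using act[OF h] by simp
    then show "y \<in> conj_class (special_orth_group d) x" using h by (auto simp: conj_class_def orbit_def)
  qed
qed

lemma orth_group_pow:
  assumes "x \<in> carrier_mat d d"
  shows "x [^]\<^bsub>orth_group d\<^esub> (k::nat) = x ^\<^sub>m k"
proof (induction k)
  case 0
  show ?case using assms by (simp add: nat_pow_def orth_group_def)
next
  case (Suc k)
  then show ?case by (simp add: nat_pow_def orth_group_def)
qed

lemma orth_similar_det_eq: "orth_similar d A B \<Longrightarrow> det A = det B"
proof -
  assume s: "orth_similar d A B"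
  then have "0 \<cdot>\<^sub>m 1\<^sub>m d + A = A" "0 \<cdot>\<^sub>m 1\<^sub>m d + B = B"
    by (auto simp: orth_similar_def intro!: eq_matI)
  then show ?thesis using orth_similar_det[OF s, of 0] by simp
qed

locale orth_conjugation =
  fixes G :: "(real mat, 'b) monoid_scheme" and n :: nat and E :: "real set"
  assumes carrier_G: "carrier G = {x \<in> carrier (orth_group (2 * n + 1)). det x \<in> E}"
    and dets: "E \<subseteq> {1,-1}"
    and conj_class_G: "x \<in> carrier G \<Longrightarrow> conj_class G x = {y. orth_similar (2 * n + 1) y x}"
    and pow_G: "x \<in> carrier_mat (2 * n + 1) (2 * n + 1) \<Longrightarrow> x [^]\<^bsub>G\<^esub> (k::nat) = x ^\<^sub>m k"
    and one_G: "\<one>\<^bsub>G\<^esub> = 1\<^sub>m (2 * n + 1)"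
begin

lemma num_eigenvalue_pairs_eq:
  assumes x: "x \<in> carrier G" and sim: "orth_similar (2 * n + 1) x (block_rotation ts e)" and e: "e \<in> {1,-1}"
  shows "num_eigenvalue_pairs G x = card (reduced_angle ` set ts)"
  unfolding num_eigenvalue_pairs_def conj_class_G[OF x]
proof (rule the_equality)
  show "\<exists>\<theta>s e. e \<in> {1, - 1} \<and> block_rotation \<theta>s e \<in> {y. orth_similar (2 * n + 1) y x} \<and>
      card (reduced_angle ` set ts) = card (reduced_angle ` set \<theta>s)"
    using orth_similar_sym[OF sim] e by (intro exI[of _ ts] exI[of _ e]) simp
next
  fix s assume "\<exists>\<theta>s e. e \<in> {1, - 1} \<and> block_rotation \<theta>s e \<in> {y. orth_similar (2 * n + 1) y x} \<and>
      s = card (reduced_angle ` set \<theta>s)"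
  then obtain us f where f: "f \<in> {1,-1}" and s: "s = card (reduced_angle ` set us)"
    and "orth_similar (2 * n + 1) (block_rotation us f) x" by blast
  then have "orth_similar (2 * n + 1) (block_rotation us f) (block_rotation ts e)"
    using sim orth_similar_trans by blast
  from block_rotation_unique(3)[OF this f] have "set (map reduced_angle ts) = set (map reduced_angle us)"
    by (metis set_mset_mset)
  then show "s = card (reduced_angle ` set ts)" using s by simp
qed

definition similarity_class :: "real multiset \<times> real \<Rightarrow> real mat set" where
  "similarity_class = (\<lambda>(M, e). {y. orth_similar (2 * n + 1) y (block_rotation (sorted_list_of_multiset M) e)})"

definition angles :: "nat \<Rightarrow> real set" where
  "angles m = {t \<in> {0..1/2}. real m * t \<in> \<int>}"

definition angle_multisets :: "nat \<Rightarrow> nat \<Rightarrow> real multiset set" where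
  "angle_multisets m s = {M. size M = n \<and> set_mset M \<subseteq> angles m \<and> card (set_mset M) = s}"

lemma classes_with_pairs_subset:
  assumes "C \<in> classes_with_pairs G m s"
  shows "C \<in> similarity_class ` (angle_multisets m s \<times> E)"
proof -
  obtain x where x: "x \<in> carrier G" and C: "C = conj_class G x"
    and all: "\<And>y. y \<in> C \<Longrightarrow> y [^]\<^bsub>G\<^esub> m = \<one>\<^bsub>G\<^esub> \<and> num_eigenvalue_pairs G y = s"
    using assms unfolding classes_with_pairs_def conj_classes_def orbits_def conj_class_def by blast
  have xO: "x \<in> carrier (orth_group (2 * n + 1))" and "det x \<in> E" using x carrier_G by auto
  then have xc: "x \<in> carrier_mat (2 * n + 1) (2 * n + 1)" by (simp add: orth_group_iff)
  then have "x \<in> C" unfolding C conj_class_G[OF x] by (simp add: orth_similar_refl)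
  from all[OF this] have xm: "x ^\<^sub>m m = 1\<^sub>m (2 * n + 1)" and xs: "num_eigenvalue_pairs G x = s"
    using pow_G[OF xc] one_G by auto
  obtain us e where us: "length us = n" and e: "e \<in> {1,-1}"
    and xu: "orth_similar (2 * n + 1) x (block_rotation us e)"
    using orth_similar_block_rotation[OF xO] by auto
  define ts where "ts = sort (map reduced_angle us)"
  have len: "length ts = n" using us by (simp add: ts_def)
  note xu
  also have "orth_similar (2 * n + 1) (block_rotation us e) (block_rotation (map reduced_angle us) e)"
    using orth_similar_block_rotation_reduced[of us e] us by simp
  also have "orth_similar (2 * n + 1) \<dots> (block_rotation ts e)"
    using orth_similar_block_rotation_sort[of "map reduced_angle us" e] us by (simp add: ts_def)
  finally have sim: "orth_similar (2 * n + 1) x (block_rotation ts e)" .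
  have "det x = e" using orth_similar_det_eq[OF sim] by (simp add: det_block_rotation)
  then have eE: "e \<in> E" using \<open>det x \<in> E\<close> by simp
  have range: "set ts \<subseteq> {0..1/2}" using reduced_angle(1) by (auto simp: ts_def)
  then have red: "reduced_angle ` set ts = set ts" using reduced_angle_eqI by force
  have "orth_similar (2 * n + 1) (block_rotation ts e ^\<^sub>m m) (1\<^sub>m (2 * n + 1))"
    using orth_similar_sym[OF orth_similar_pow[OF sim, of m]] xm by simp
  then have "block_rotation ts e ^\<^sub>m m = 1\<^sub>m (2 * n + 1)" by (rule orth_similar_oneD)
  then have "\<forall>t \<in> set ts. real m * t \<in> \<int>" using block_rotation_pow_eq_one_iff[of ts e m] len by simp
  moreover have "card (set ts) = s" using num_eigenvalue_pairs_eq[OF x sim e] xs red by simp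
  ultimately have "mset ts \<in> angle_multisets m s"
    using range len by (auto simp: angle_multisets_def angles_def)
  moreover have "C = similarity_class (mset ts, e)"
  proof -
    have "sorted_list_of_multiset (mset ts) = sort ts" by simp
    also have "sort ts = ts" by (intro sorted_sort_id) (simp add: ts_def)
    finally have "sorted_list_of_multiset (mset ts) = ts" .
    then have "similarity_class (mset ts, e) = {y. orth_similar (2 * n + 1) y (block_rotation ts e)}"
      by (simp add: similarity_class_def)
    moreover have "orth_similar (2 * n + 1) y x \<longleftrightarrow> orth_similar (2 * n + 1) y (block_rotation ts e)" for y
      using orth_similar_trans[OF _ sim] orth_similar_trans[OF _ orth_similar_sym[OF sim]] by blast
    ultimately show ?thesis unfolding C conj_class_G[OF x] by simp
  qed
  ultimately show ?thesis using eE by blast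
qed

lemma similarity_class_mem:
  assumes M: "M \<in> angle_multisets m s" and e: "e \<in> E" and m: "even m"
  shows "similarity_class (M, e) \<in> classes_with_pairs G m s"
proof -
  define ts where "ts = sorted_list_of_multiset M"
  have mts: "mset ts = M" by (simp add: ts_def)
  have len: "length ts = n" and sub: "set ts \<subseteq> angles m" and card: "card (set ts) = s"
    using M unfolding mts[symmetric] angle_multisets_def by auto
  have e1: "e \<in> {1,-1}" using e dets by auto
  let ?B = "block_rotation ts e"
  have BO: "?B \<in> carrier (orth_group (2 * n + 1))" using orth_block_rotation[OF e1, of ts] len by simp
  then have B: "?B \<in> carrier G" using e carrier_G by (simp add: det_block_rotation)
  have cls: "similarity_class (M, e) = conj_class G ?B"
    unfolding conj_class_G[OF B] similarity_class_def by (simp add: ts_def)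
  have "e ^ m = 1" using e1 m by auto
  then have Bm: "?B ^\<^sub>m m = 1\<^sub>m (2 * n + 1)"
    using block_rotation_pow_eq_one_iff[of ts e m] len sub by (auto simp: angles_def)
  have red: "reduced_angle ` set ts = set ts" using sub reduced_angle_eqI by (force simp: angles_def)
  have "y [^]\<^bsub>G\<^esub> m = \<one>\<^bsub>G\<^esub> \<and> num_eigenvalue_pairs G y = s" if "y \<in> similarity_class (M, e)" for y
  proof
    have sim: "orth_similar (2 * n + 1) y ?B" using that by (simp add: similarity_class_def ts_def)
    then have yc: "y \<in> carrier_mat (2 * n + 1) (2 * n + 1)" by (simp add: orth_similar_def)
    have y: "y \<in> carrier G"
      using orth_similar_orth[OF orth_similar_sym[OF sim] BO] orth_similar_det_eq[OF sim] e
      by (simp add: carrier_G det_block_rotation)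
    have "orth_similar (2 * n + 1) (y ^\<^sub>m m) (1\<^sub>m (2 * n + 1))"
      using orth_similar_pow[OF sim, of m] Bm by simp
    then show "y [^]\<^bsub>G\<^esub> m = \<one>\<^bsub>G\<^esub>" unfolding pow_G[OF yc] one_G by (rule orth_similar_oneD)
    show "num_eigenvalue_pairs G y = s"
      using num_eigenvalue_pairs_eq[OF y sim e1] red card by simp
  qed
  moreover have "similarity_class (M, e) \<in> conj_classes G"
    unfolding cls conj_classes_def orbits_def conj_class_def using B by auto
  ultimately show ?thesis by (auto simp: classes_with_pairs_def)
qed

lemma inj_on_similarity_class: "inj_on similarity_class (angle_multisets m s \<times> E)"
proof (rule inj_onI, clarify)
  fix M e M' e'
  assume M: "M \<in> angle_multisets m s" and e: "e \<in> E"
    and M': "M' \<in> angle_multisets m s" and e': "e' \<in> E"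
    and eq: "similarity_class (M, e) = similarity_class (M', e')"
  let ?ts = "sorted_list_of_multiset M" and ?us = "sorted_list_of_multiset M'"
  have "length ?ts = size M" by (metis mset_sorted_list_of_multiset size_mset)
  then have "length ?ts = n" using M by (simp add: angle_multisets_def)
  then have "block_rotation ?ts e \<in> similarity_class (M, e)"
    using block_rotation_carrier[of ?ts e] by (simp add: similarity_class_def orth_similar_refl)
  then have sim: "orth_similar (2 * n + 1) (block_rotation ?ts e) (block_rotation ?us e')"
    unfolding eq by (simp add: similarity_class_def)
  have e1: "e \<in> {1,-1}" using e dets by auto
  have red: "mset (map reduced_angle (sorted_list_of_multiset M)) = M" if "M \<in> angle_multisets m s" for M
  proof -
    have "image_mset reduced_angle M = image_mset id M"
      using that by (intro image_mset_cong) (auto simp: angle_multisets_def angles_def intro!: reduced_angle_eqI)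
    then show ?thesis by simp
  qed
  show "M = M' \<and> e = e'"
    using block_rotation_unique(1,3)[OF sim e1] red[OF M] red[OF M'] by simp
qed

lemma classes_with_pairs_eq:
  assumes "even m"
  shows "classes_with_pairs G m s = similarity_class ` (angle_multisets m s \<times> E)"
  using classes_with_pairs_subset similarity_class_mem[OF _ _ assms] by auto

lemma finite_card_angles:
  assumes k: "k > 0"
  shows "finite (angles (2 * k))" "card (angles (2 * k)) = k + 1"
proof -
  have "angles (2 * k) = (\<lambda>j. real j / real (2 * k)) ` {0..k}"
  proof (intro equalityI subsetI)
    fix t assume "t \<in> angles (2 * k)"
    then have t: "0 \<le> t" "t \<le> 1/2" and "real (2 * k) * t \<in> \<int>" by (auto simp: angles_def)
    then obtain i :: int where i: "real (2 * k) * t = i" by (auto elim: Ints_cases)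
    have "0 \<le> real (2 * k) * t" using t by simp
    then have i0: "i \<ge> 0" unfolding i by simp
    have "real (2 * k) * t \<le> real (2 * k) * (1/2)" using t by (intro mult_left_mono) auto
    then have "i \<le> int k" unfolding i by simp
    moreover have "t = real (nat i) / real (2 * k)" using i i0 k by (simp add: field_simps)
    ultimately show "t \<in> (\<lambda>j. real j / real (2 * k)) ` {0..k}" using i0 by (intro image_eqI[of _ _ "nat i"]) auto
  next
    fix t assume "t \<in> (\<lambda>j. real j / real (2 * k)) ` {0..k}"
    then show "t \<in> angles (2 * k)" using k by (auto simp: angles_def field_simps)
  qed
  moreover have "inj_on (\<lambda>j. real j / real (2 * k)) {0..k}" using k by (auto simp: inj_on_def)
  ultimately show "finite (angles (2 * k))" "card (angles (2 * k)) = k + 1" by (simp_all add: card_image)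
qed

lemma finite_N_eq:
  assumes n: "n > 0" and s: "s > 0" and k: "k > 0"
  shows "finite (classes_with_pairs G (2 * k) s)"
    and "real (N G (2 * k) s) = real (card E) * (real s / real n * real (n choose s) * real ((k + 1) choose s))"
proof -
  have E: "finite E" using dets finite_subset by blast
  note A = finite_card_angles[OF k]
  note S = finite_card_multisets_support_size[OF A(1) n s, folded angle_multisets_def]
  have eq: "classes_with_pairs G (2 * k) s = similarity_class ` (angle_multisets (2 * k) s \<times> E)"
    by (rule classes_with_pairs_eq) simp
  show "finite (classes_with_pairs G (2 * k) s)" unfolding eq using S(1) E by simp
  have "N G (2 * k) s = ((k + 1) choose s) * ((n - 1) choose (s - 1)) * card E"
    unfolding N_def eq card_image[OF inj_on_similarity_class] card_cartesian_product S(2) A(2) ..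
  moreover have "real n * real ((n - 1) choose (s - 1)) = real s * real (n choose s)"
    using binomial_absorption[of "s - 1" n] n s by (metis Suc_pred' of_nat_mult)
  then have "real ((n - 1) choose (s - 1)) = real s / real n * real (n choose s)"
    using n by (simp add: field_simps)
  ultimately show "real (N G (2 * k) s) =
      real (card E) * (real s / real n * real (n choose s) * real ((k + 1) choose s))"
    by simp
qed

end

lemma orth_conjugation_orth_group: "orth_conjugation (orth_group (2 * n + 1)) n {1,-1}"
proof
  show "carrier (orth_group (2 * n + 1)) = {x \<in> carrier (orth_group (2 * n + 1)). det x \<in> {1, - 1}}"
    using orth_det by blast
  show "\<one>\<^bsub>orth_group (2 * n + 1)\<^esub> = 1\<^sub>m (2 * n + 1)" by (simp add: orth_group_def)
qed (simp_all only: conj_class_orth_group orth_group_pow subset_refl)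

lemma orth_conjugation_special_orth_group: "orth_conjugation (special_orth_group (2 * n + 1)) n {1}"
proof
  show "conj_class (special_orth_group (2 * n + 1)) x = {y. orth_similar (2 * n + 1) y x}"
    if "x \<in> carrier (special_orth_group (2 * n + 1))" for x
    using that conj_class_special_orth_group[OF that] conj_class_orth_group
    by (simp add: special_orth_group_iff)
  show "x [^]\<^bsub>special_orth_group (2 * n + 1)\<^esub> k = x ^\<^sub>m k"
    if "x \<in> carrier_mat (2 * n + 1) (2 * n + 1)" for x and k :: nat
    using orth_group_pow[OF that, of k] by (simp add: nat_pow_def special_orth_group_def)
qed (auto simp: special_orth_group_def orth_group_def)

theorem theorem19:
  fixes n s m k :: nat
  assumes "n > 0" and "s > 0" and "m > 0" and "m = 2 * k"
  shows "finite (classes_with_pairs (special_orth_group (2 * n + 1)) m s) \<and>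
         real (N (special_orth_group (2 * n + 1)) m s)
           = real s / real n * real (n choose s) * real ((m div 2 + 1) choose s) \<and>
         finite (classes_with_pairs (orth_group (2 * n + 1)) m s) \<and>
         real (N (orth_group (2 * n + 1)) m s)
           = 2 * real s / real n * real (n choose s) * real ((m div 2 + 1) choose s)"
proof -
  have k: "k > 0" and m: "m div 2 = k" using assms by auto
  show ?thesis
    using orth_conjugation.finite_N_eq[OF orth_conjugation_special_orth_group assms(1,2) k]
      orth_conjugation.finite_N_eq[OF orth_conjugation_orth_group assms(1,2) k]
    unfolding m unfolding assms(4) by simp
qed

end
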